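(* For any $C\in\mathbb{A}$, the Dirac map $$\delta_{R\otimes\gamma^{*}(C)}: R\otimes\gamma^{*}(C)\longrightarrow \bigl((R\otimes\gamma^{*}(C))\pitchfork_{R}R\bigr)\pitchfork R$$ is an isomorphism of $R$-algebras in $\mathcal{E}$.
   Context: Let $\mathbb{T}$ be a finitary algebraic theory, and let $\mathbb{A}$ be a small full subcategory of the category of $\mathbb{T}$-algebras (in sets), closed under finite coproducts of $\mathbb{T}$-algebras (for instance, the category of finitely presented $\mathbb{T}$-algebras). Let $\mathcal{E}=[\mathbb{A},\mathrm{Set}]$ be the topos of covariant functors $\mathbb{A}\to\mathrm{Set}$. $R\in\mathcal{E}$ is the forgetful functor $\mathbb{A}\to\mathrm{Set}$, $R(B)=B$; it is a $\mathbb{T}$-algebra object in $\mathcal{E}$ (with the $\mathbb{T}$-structure of each $B$). For $C\in\mathbb{A}$, $\gamma^{*}(C)\in\mathcal{E}$ is the constant functor with value (the underlying set of) $C$; it is a $\mathbb{T}$-algebra object in $\mathcal{E}$ via the $\mathbb{T}$-structure of $C$. The symbol $\otimes$ denotes binary coproduct of $\mathbb{T}$-algebras (in sets or in $\mathcal{E}$). Notation: $Q\pitchfork Z$ denotes the exponential object $Z^{Q}$ in $\mathcal{E}$. An $R$-algebra in $\mathcal{E}$ is a $\mathbb{T}$-algebra $X$ in $\mathcal{E}$ equipped with a $\mathbb{T}$-homomorphism $R\to X$ (its structure map), and morphisms of $R$-algebras are $\mathbb{T}$-homomorphisms commuting with the structure maps; $R$ is itself an $R$-algebra via the identity, and $R\otimes\gamma^{*}(C)$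 is an $R$-algebra via the first coproduct inclusion. For $R$-algebras $X,Z$, $X\pitchfork_{R}Z\subseteq X\pitchfork Z$ is the subobject of $R$-algebra morphisms: a map $P\to X\pitchfork Z$ factors through it iff the corresponding map $P\times X\to Z$ is an $R$-algebra morphism in the variable $X$ (i.e. in the internal sense it preserves, for each fixed value of the $P$-variable, all $\mathbb{T}$-operations and the structure map from $R$). For any $S\in\mathcal{E}$, $S\pitchfork R$ is a $\mathbb{T}$-algebra with the pointwise structure inherited from $R$, and an $R$-algebra via the map $R\to S\pitchfork R$ that is the exponential transpose of the projection $R\times S\to R$. For an $R$-algebra $X$, $\delta_{X}:X\to (X\pitchfork_{R}R)\pitchfork R$ is the composite of the map $X\to (X\pitchfork R)\pitchfork R$ (the exponential transpose of evaluation $X\times (X\pitchfork R)\to R$) with $s\pitchfork R:(X\pitchfork R)\pitchfork R\to (X\pitchfork_R R)\pitchfork R$, where $s:X\pitchfork_{R}R\to X\pitchfork R$ is the inclusion; it is an $R$-algebra morphism. *)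

theory Defs
  imports "HOL-Library.FuncSet"
begin

section \<open>Finitary algebraic theories and their algebras in sets\<close>

datatype ('f, 'v) trm = Var 'v | App 'f "('f, 'v) trm list"

text \<open>
  A presentation of a finitary (one-sorted) algebraic theory.  The operation symbols form a set,
  not a whole type, so that the empty signature is covered.
\<close>

record 'f alg_theory =
  ops :: "'f set"
  ar :: "'f \<Rightarrow> nat"
  eqs :: "(('f, nat) trm \<times> ('f, nat) trm) set"

inductive_set terms :: "'f alg_theory \<Rightarrow> 'v set \<Rightarrow> ('f, 'v) trm set"
  for T :: "'f alg_theory" and G :: "'v set" where
  Var: "x \<in> G \<Longrightarrow> Var x \<in> terms T G"
| App: "\<sigma> \<in> ops T \<Longrightarrow> length ts = ar T \<sigma> \<Longrightarrow> \<forall>t\<in>set ts. t \<in> terms T G \<Longrightarrow> App \<sigma> ts \<in> terms T G"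

definition wf_theory :: "'f alg_theory \<Rightarrow> bool" where
  "wf_theory T \<longleftrightarrow> eqs T \<subseteq> terms T UNIV \<times> terms T UNIV"

primrec term_val :: "('f \<Rightarrow> 'a list \<Rightarrow> 'a) \<Rightarrow> ('v \<Rightarrow> 'a) \<Rightarrow> ('f, 'v) trm \<Rightarrow> 'a" where
  "term_val I v (Var x) = v x"
| "term_val I v (App \<sigma> ts) = I \<sigma> (map (term_val I v) ts)"

abbreviation subst :: "('v \<Rightarrow> ('f, 'w) trm) \<Rightarrow> ('f, 'v) trm \<Rightarrow> ('f, 'w) trm" where
  "subst \<equiv> term_val App"

text \<open>Carriers may be empty.\<close>

record ('f, 'a) alg =
  car :: "'a set"
  opn :: "'f \<Rightarrow> 'a list \<Rightarrow> 'a"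

definition args :: "'f alg_theory \<Rightarrow> 'f \<Rightarrow> 'a set \<Rightarrow> 'a list set" where
  "args T \<sigma> S = {xs. length xs = ar T \<sigma> \<and> set xs \<subseteq> S}"

definition is_alg :: "'f alg_theory \<Rightarrow> ('f, 'a) alg \<Rightarrow> bool" where
  "is_alg T M \<longleftrightarrow>
     (\<forall>\<sigma>\<in>ops T. \<forall>xs\<in>args T \<sigma> (car M). opn M \<sigma> xs \<in> car M) \<and>
     (\<forall>(s, t)\<in>eqs T. \<forall>v. range v \<subseteq> car M \<longrightarrow> term_val (opn M) v s = term_val (opn M) v t)"

text \<open>
  Homomorphisms are undefined outside the carrier of their domain, so that the hom-sets
  contain each homomorphism exactly once.
\<close>

definition alg_hom :: "'f alg_theory \<Rightarrow> ('f, 'a) alg \<Rightarrow> ('f, 'b) alg \<Rightarrow> ('a \<Rightarrow> 'b) set" where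
  "alg_hom T M N = {h \<in> car M \<rightarrow>\<^sub>E car N.
     \<forall>\<sigma>\<in>ops T. \<forall>xs\<in>args T \<sigma> (car M). h (opn M \<sigma> xs) = opn N \<sigma> (map h xs)}"

definition alg_id :: "('f, 'a) alg \<Rightarrow> 'a \<Rightarrow> 'a" where
  "alg_id M = (\<lambda>x\<in>car M. x)"

definition alg_isomorphic :: "'f alg_theory \<Rightarrow> ('f, 'a) alg \<Rightarrow> ('f, 'b) alg \<Rightarrow> bool" where
  "alg_isomorphic T M N \<longleftrightarrow> (\<exists>h\<in>alg_hom T M N. \<exists>k\<in>alg_hom T N M.
     compose (car M) k h = alg_id M \<and> compose (car N) h k = alg_id N)"

text \<open>
  The algebra presented by generators \<open>G\<close> and relations \<open>E\<close>: terms modulo the least congruence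
  containing \<open>E\<close> and all instances of the equations of the theory.
\<close>

inductive pres_eq :: "'f alg_theory \<Rightarrow> 'v set \<Rightarrow> (('f, 'v) trm \<times> ('f, 'v) trm) set
    \<Rightarrow> ('f, 'v) trm \<Rightarrow> ('f, 'v) trm \<Rightarrow> bool"
  for T :: "'f alg_theory" and G :: "'v set" and E :: "(('f, 'v) trm \<times> ('f, 'v) trm) set" where
  refl: "t \<in> terms T G \<Longrightarrow> pres_eq T G E t t"
| sym: "pres_eq T G E s t \<Longrightarrow> pres_eq T G E t s"
| trans: "pres_eq T G E s t \<Longrightarrow> pres_eq T G E t u \<Longrightarrow> pres_eq T G E s u"
| rel: "(s, t) \<in> E \<Longrightarrow> pres_eq T G E s t"
| ax: "(s, t) \<in> eqs T \<Longrightarrow> range v \<subseteq> terms T G \<Longrightarrow> pres_eq T G E (subst v s) (subst v t)"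
| cong: "\<sigma> \<in> ops T \<Longrightarrow> length ss = ar T \<sigma> \<Longrightarrow> list_all2 (pres_eq T G E) ss ts
    \<Longrightarrow> pres_eq T G E (App \<sigma> ss) (App \<sigma> ts)"

definition pres_class :: "'f alg_theory \<Rightarrow> 'v set \<Rightarrow> (('f, 'v) trm \<times> ('f, 'v) trm) set
    \<Rightarrow> ('f, 'v) trm \<Rightarrow> ('f, 'v) trm set" where
  "pres_class T G E t = {s. pres_eq T G E s t}"

definition pres_alg :: "'f alg_theory \<Rightarrow> 'v set \<Rightarrow> (('f, 'v) trm \<times> ('f, 'v) trm) set
    \<Rightarrow> ('f, ('f, 'v) trm set) alg" where
  "pres_alg T G E = \<lparr>car = pres_class T G E ` terms T G,
     opn = \<lambda>\<sigma> Xs. {t. \<exists>ts. list_all2 (\<in>) ts Xs \<and> pres_eq T G E t (App \<sigma> ts)}\<rparr>"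

definition initial_alg :: "'f alg_theory \<Rightarrow> ('f, ('f, 'v) trm set) alg" where
  "initial_alg T = pres_alg T {} {}"

text \<open>
  The coproduct of two algebras is presented by the disjoint union of the carriers, subject to the
  graphs of the operations of both algebras.
\<close>

definition coprod_rels :: "'f alg_theory \<Rightarrow> ('f, 'a) alg \<Rightarrow> ('f, 'b) alg
    \<Rightarrow> (('f, 'a + 'b) trm \<times> ('f, 'a + 'b) trm) set" where
  "coprod_rels T M N =
     {(App \<sigma> (map (\<lambda>x. Var (Inl x)) xs), Var (Inl (opn M \<sigma> xs))) | \<sigma> xs.
        \<sigma> \<in> ops T \<and> xs \<in> args T \<sigma> (car M)} \<union>
     {(App \<sigma> (map (\<lambda>y. Var (Inr y)) ys), Var (Inr (opn N \<sigma> ys))) | \<sigma> ys.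
        \<sigma> \<in> ops T \<and> ys \<in> args T \<sigma> (car N)}"

definition coprod_class :: "'f alg_theory \<Rightarrow> ('f, 'a) alg \<Rightarrow> ('f, 'b) alg
    \<Rightarrow> ('f, 'a + 'b) trm \<Rightarrow> ('f, 'a + 'b) trm set" where
  "coprod_class T M N = pres_class T (car M <+> car N) (coprod_rels T M N)"

definition alg_coprod :: "'f alg_theory \<Rightarrow> ('f, 'a) alg \<Rightarrow> ('f, 'b) alg
    \<Rightarrow> ('f, ('f, 'a + 'b) trm set) alg" where
  "alg_coprod T M N = pres_alg T (car M <+> car N) (coprod_rels T M N)"

definition alg_inl :: "'f alg_theory \<Rightarrow> ('f, 'a) alg \<Rightarrow> ('f, 'b) alg
    \<Rightarrow> 'a \<Rightarrow> ('f, 'a + 'b) trm set" where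
  "alg_inl T M N = (\<lambda>x\<in>car M. coprod_class T M N (Var (Inl x)))"

definition alg_inr :: "'f alg_theory \<Rightarrow> ('f, 'a) alg \<Rightarrow> ('f, 'b) alg
    \<Rightarrow> 'b \<Rightarrow> ('f, 'a + 'b) trm set" where
  "alg_inr T M N = (\<lambda>y\<in>car N. coprod_class T M N (Var (Inr y)))"

text \<open>
  A small full subcategory is given by the set \<open>A\<close> of its objects; it need not be replete, so it is
  closed under finite coproducts if it contains an isomorphic copy of each of them.
\<close>

definition closed_fin_coprod :: "'f alg_theory \<Rightarrow> ('f, 'a) alg set \<Rightarrow> bool" where
  "closed_fin_coprod T A \<longleftrightarrow>
     (\<exists>I\<in>A. alg_isomorphic T I (initial_alg T :: ('f, ('f, 'a) trm set) alg)) \<and>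
     (\<forall>M\<in>A. \<forall>N\<in>A. \<exists>P\<in>A. alg_isomorphic T P (alg_coprod T M N))"


section \<open>The topos of functors from \<open>A\<close> to sets\<close>

text \<open>
  \<open>act F B D f\<close> is the action of \<open>F\<close> on \<open>f : B \<rightarrow> D\<close>.  All data are relevant only at objects of \<open>A\<close>,
  homomorphisms between them and elements of the sets \<open>ob F B\<close>.
\<close>

record ('f, 'a, 'x) copsh =
  ob :: "('f, 'a) alg \<Rightarrow> 'x set"
  act :: "('f, 'a) alg \<Rightarrow> ('f, 'a) alg \<Rightarrow> ('a \<Rightarrow> 'a) \<Rightarrow> 'x \<Rightarrow> 'x"

definition is_functor :: "'f alg_theory \<Rightarrow> ('f, 'a) alg set \<Rightarrow> ('f, 'a, 'x, 'm) copsh_scheme \<Rightarrow> bool" where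
  "is_functor T A F \<longleftrightarrow>
     (\<forall>B\<in>A. \<forall>D\<in>A. \<forall>f\<in>alg_hom T B D. act F B D f \<in> ob F B \<rightarrow> ob F D) \<and>
     (\<forall>B\<in>A. \<forall>x\<in>ob F B. act F B B (alg_id B) x = x) \<and>
     (\<forall>B\<in>A. \<forall>D\<in>A. \<forall>E\<in>A. \<forall>f\<in>alg_hom T B D. \<forall>g\<in>alg_hom T D E. \<forall>x\<in>ob F B.
        act F B E (compose (car B) g f) x = act F D E g (act F B D f x))"

definition is_nat :: "'f alg_theory \<Rightarrow> ('f, 'a) alg set \<Rightarrow> ('f, 'a, 'x, 'm) copsh_scheme
    \<Rightarrow> ('f, 'a, 'y, 'n) copsh_scheme \<Rightarrow> (('f, 'a) alg \<Rightarrow> 'x \<Rightarrow> 'y) \<Rightarrow> bool" where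
  "is_nat T A F G \<alpha> \<longleftrightarrow>
     (\<forall>B\<in>A. \<alpha> B \<in> ob F B \<rightarrow> ob G B) \<and>
     (\<forall>B\<in>A. \<forall>D\<in>A. \<forall>f\<in>alg_hom T B D. \<forall>x\<in>ob F B. \<alpha> D (act F B D f x) = act G B D f (\<alpha> B x))"

definition prodE :: "('f, 'a, 'x, 'm) copsh_scheme \<Rightarrow> ('f, 'a, 'y, 'n) copsh_scheme
    \<Rightarrow> ('f, 'a, 'x \<times> 'y) copsh" where
  "prodE F G = \<lparr>ob = \<lambda>B. ob F B \<times> ob G B,
     act = \<lambda>B D f. map_prod (act F B D f) (act G B D f)\<rparr>"

text \<open>
  The exponential \<open>Q \<pitchfork> Z\<close>: its value at \<open>B\<close> is the set of natural transformations from
  \<open>Hom(B, -) \<times> Q\<close> to \<open>Z\<close>, each encoded as one function of triples \<open>(D, f, q)\<close> with \<open>f : B \<rightarrow> D\<close> and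
  \<open>q \<in> Q D\<close>.
\<close>

definition exp_dom :: "'f alg_theory \<Rightarrow> ('f, 'a) alg set \<Rightarrow> ('f, 'a, 'q, 'm) copsh_scheme
    \<Rightarrow> ('f, 'a) alg \<Rightarrow> (('f, 'a) alg \<times> ('a \<Rightarrow> 'a) \<times> 'q) set" where
  "exp_dom T A Q B = {(D, f, q). D \<in> A \<and> f \<in> alg_hom T B D \<and> q \<in> ob Q D}"

type_synonym ('f, 'a, 'q, 'z) expel = "('f, 'a) alg \<times> ('a \<Rightarrow> 'a) \<times> 'q \<Rightarrow> 'z"

definition expE :: "'f alg_theory \<Rightarrow> ('f, 'a) alg set \<Rightarrow> ('f, 'a, 'q, 'm) copsh_scheme
    \<Rightarrow> ('f, 'a, 'z, 'n) copsh_scheme \<Rightarrow> ('f, 'a, ('f, 'a, 'q, 'z) expel) copsh" where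
  "expE T A Q Z =
     \<lparr>ob = \<lambda>B. {\<theta> \<in> extensional (exp_dom T A Q B).
        (\<forall>D\<in>A. \<forall>f\<in>alg_hom T B D. \<forall>q\<in>ob Q D. \<theta> (D, f, q) \<in> ob Z D) \<and>
        (\<forall>D\<in>A. \<forall>E\<in>A. \<forall>f\<in>alg_hom T B D. \<forall>g\<in>alg_hom T D E. \<forall>q\<in>ob Q D.
           \<theta> (E, compose (car B) g f, act Q D E g q) = act Z D E g (\<theta> (D, f, q)))},
      act = \<lambda>B B' g \<theta>. \<lambda>(D, f, q)\<in>exp_dom T A Q B'. \<theta> (D, compose (car B) f g, q)\<rparr>"

text \<open>Evaluation \<open>Q \<times> (Q \<pitchfork> Z) \<rightarrow> Z\<close>, and the transpose \<open>P \<rightarrow> Q \<pitchfork> Z\<close> of a map \<open>P \<times> Q \<rightarrow> Z\<close>.\<close>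

definition evalE :: "('f, 'a) alg \<Rightarrow> 'q \<times> ('f, 'a, 'q, 'z) expel \<Rightarrow> 'z" where
  "evalE B = (\<lambda>(q, \<theta>). \<theta> (B, alg_id B, q))"

definition transpose :: "'f alg_theory \<Rightarrow> ('f, 'a) alg set \<Rightarrow> ('f, 'a, 'p, 'm) copsh_scheme
    \<Rightarrow> ('f, 'a, 'q, 'n) copsh_scheme \<Rightarrow> (('f, 'a) alg \<Rightarrow> 'p \<times> 'q \<Rightarrow> 'z)
    \<Rightarrow> ('f, 'a) alg \<Rightarrow> 'p \<Rightarrow> ('f, 'a, 'q, 'z) expel" where
  "transpose T A P Q \<alpha> B p = (\<lambda>(D, f, q)\<in>exp_dom T A Q B. \<alpha> D (act P B D f p, q))"

text \<open>The map \<open>s \<pitchfork> Z : (Q \<pitchfork> Z) \<rightarrow> (Q' \<pitchfork> Z)\<close> induced by \<open>s : Q' \<rightarrow> Q\<close>.\<close>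

definition precompE :: "'f alg_theory \<Rightarrow> ('f, 'a) alg set \<Rightarrow> ('f, 'a, 'r, 'm) copsh_scheme
    \<Rightarrow> (('f, 'a) alg \<Rightarrow> 'r \<Rightarrow> 'q) \<Rightarrow> ('f, 'a) alg
    \<Rightarrow> ('f, 'a, 'q, 'z) expel \<Rightarrow> ('f, 'a, 'r, 'z) expel" where
  "precompE T A Q' s B \<theta> = (\<lambda>(D, f, q)\<in>exp_dom T A Q' B. \<theta> (D, f, s D q))"


section \<open>Algebra objects and \<open>R\<close>-algebras\<close>

text \<open>
  Finite powers of functors are computed pointwise.  So operations \<open>X\<^sup>n \<rightarrow> X\<close> satisfying the equations
  of the theory amount to an algebra structure on each \<open>ob X B\<close>, natural in \<open>B\<close>.
\<close>

record ('f, 'a, 'x) talg = "('f, 'a, 'x) copsh" +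
  opE :: "('f, 'a) alg \<Rightarrow> 'f \<Rightarrow> 'x list \<Rightarrow> 'x"

definition alg_at :: "('f, 'a, 'x, 'm) talg_scheme \<Rightarrow> ('f, 'a) alg \<Rightarrow> ('f, 'x) alg" where
  "alg_at X B = \<lparr>car = ob X B, opn = opE X B\<rparr>"

definition is_talg :: "'f alg_theory \<Rightarrow> ('f, 'a) alg set \<Rightarrow> ('f, 'a, 'x, 'm) talg_scheme \<Rightarrow> bool" where
  "is_talg T A X \<longleftrightarrow> is_functor T A X \<and>
     (\<forall>B\<in>A. is_alg T (alg_at X B)) \<and>
     (\<forall>B\<in>A. \<forall>D\<in>A. \<forall>f\<in>alg_hom T B D. \<forall>\<sigma>\<in>ops T. \<forall>xs\<in>args T \<sigma> (ob X B).
        act X B D f (opE X B \<sigma> xs) = opE X D \<sigma> (map (act X B D f) xs))"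

definition talg_mor :: "'f alg_theory \<Rightarrow> ('f, 'a) alg set \<Rightarrow> ('f, 'a, 'x, 'm) talg_scheme
    \<Rightarrow> ('f, 'a, 'y, 'n) talg_scheme \<Rightarrow> (('f, 'a) alg \<Rightarrow> 'x \<Rightarrow> 'y) \<Rightarrow> bool" where
  "talg_mor T A X Y \<alpha> \<longleftrightarrow> is_nat T A X Y \<alpha> \<and>
     (\<forall>B\<in>A. \<forall>\<sigma>\<in>ops T. \<forall>xs\<in>args T \<sigma> (ob X B). \<alpha> B (opE X B \<sigma> xs) = opE Y B \<sigma> (map (\<alpha> B) xs))"

definition R_obj :: "('f, 'a, 'a) talg" where
  "R_obj = \<lparr>ob = car, act = \<lambda>B D f. f, opE = opn\<rparr>"

definition gamma_obj :: "('f, 'a) alg \<Rightarrow> ('f, 'a, 'a) talg" where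
  "gamma_obj C = \<lparr>ob = \<lambda>B. car C, act = \<lambda>B D f x. x, opE = \<lambda>B. opn C\<rparr>"

text \<open>
  The coproduct \<open>X \<otimes> Y\<close> of algebra objects.  An arrow acts on a congruence class by acting on the
  generators in its terms; all members of a class give the same union component.
\<close>

definition tensorE :: "'f alg_theory \<Rightarrow> ('f, 'a, 'x, 'm) talg_scheme \<Rightarrow> ('f, 'a, 'y, 'n) talg_scheme
    \<Rightarrow> ('f, 'a, ('f, 'x + 'y) trm set) talg" where
  "tensorE T X Y =
     \<lparr>ob = \<lambda>B. car (alg_coprod T (alg_at X B) (alg_at Y B)),
      act = \<lambda>B D f u. \<Union>t\<in>u. coprod_class T (alg_at X D) (alg_at Y D)
              (map_trm id (map_sum (act X B D f) (act Y B D f)) t),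
      opE = \<lambda>B. opn (alg_coprod T (alg_at X B) (alg_at Y B))\<rparr>"

definition inlE :: "'f alg_theory \<Rightarrow> ('f, 'a, 'x, 'm) talg_scheme \<Rightarrow> ('f, 'a, 'y, 'n) talg_scheme
    \<Rightarrow> ('f, 'a) alg \<Rightarrow> 'x \<Rightarrow> ('f, 'x + 'y) trm set" where
  "inlE T X Y B = alg_inl T (alg_at X B) (alg_at Y B)"

definition inrE :: "'f alg_theory \<Rightarrow> ('f, 'a, 'x, 'm) talg_scheme \<Rightarrow> ('f, 'a, 'y, 'n) talg_scheme
    \<Rightarrow> ('f, 'a) alg \<Rightarrow> 'y \<Rightarrow> ('f, 'x + 'y) trm set" where
  "inrE T X Y B = alg_inr T (alg_at X B) (alg_at Y B)"

record ('f, 'a, 'x) ralg = "('f, 'a, 'x) talg" +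
  str :: "('f, 'a) alg \<Rightarrow> 'a \<Rightarrow> 'x"

definition is_ralg :: "'f alg_theory \<Rightarrow> ('f, 'a) alg set \<Rightarrow> ('f, 'a, 'x, 'm) ralg_scheme \<Rightarrow> bool" where
  "is_ralg T A X \<longleftrightarrow> is_talg T A X \<and> talg_mor T A R_obj X (str X)"

definition ralg_mor :: "'f alg_theory \<Rightarrow> ('f, 'a) alg set \<Rightarrow> ('f, 'a, 'x, 'm) ralg_scheme
    \<Rightarrow> ('f, 'a, 'y, 'n) ralg_scheme \<Rightarrow> (('f, 'a) alg \<Rightarrow> 'x \<Rightarrow> 'y) \<Rightarrow> bool" where
  "ralg_mor T A X Y \<alpha> \<longleftrightarrow> is_ralg T A X \<and> is_ralg T A Y \<and> talg_mor T A X Y \<alpha> \<and>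
     (\<forall>B\<in>A. \<forall>r\<in>car B. \<alpha> B (str X B r) = str Y B r)"

definition ralg_iso :: "'f alg_theory \<Rightarrow> ('f, 'a) alg set \<Rightarrow> ('f, 'a, 'x, 'm) ralg_scheme
    \<Rightarrow> ('f, 'a, 'y, 'n) ralg_scheme \<Rightarrow> (('f, 'a) alg \<Rightarrow> 'x \<Rightarrow> 'y) \<Rightarrow> bool" where
  "ralg_iso T A X Y \<alpha> \<longleftrightarrow> ralg_mor T A X Y \<alpha> \<and>
     (\<exists>\<beta>. ralg_mor T A Y X \<beta> \<and>
        (\<forall>B\<in>A. (\<forall>x\<in>ob X B. \<beta> B (\<alpha> B x) = x) \<and> (\<forall>y\<in>ob Y B. \<alpha> B (\<beta> B y) = y)))"

definition R_ralg :: "('f, 'a, 'a) ralg" where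
  "R_ralg = talg.extend R_obj (ralg.fields (\<lambda>B r. r))"

definition R_tensor :: "'f alg_theory \<Rightarrow> ('f, 'a, 'y, 'n) talg_scheme
    \<Rightarrow> ('f, 'a, ('f, 'a + 'y) trm set) ralg" where
  "R_tensor T Y = talg.extend (tensorE T R_obj Y) (ralg.fields (inlE T R_obj Y))"

text \<open>
  \<open>X \<pitchfork>\<^sub>R Z\<close> as a subfunctor of \<open>X \<pitchfork> Z\<close>: an element at stage \<open>B\<close> must be an \<open>R\<close>-algebra morphism
  at every later stage \<open>f : B \<rightarrow> D\<close>.
\<close>

definition homR :: "'f alg_theory \<Rightarrow> ('f, 'a) alg set \<Rightarrow> ('f, 'a, 'x, 'm) ralg_scheme
    \<Rightarrow> ('f, 'a, 'z, 'n) ralg_scheme \<Rightarrow> ('f, 'a, ('f, 'a, 'x, 'z) expel) copsh" where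
  "homR T A X Z =
     \<lparr>ob = \<lambda>B. {\<theta> \<in> ob (expE T A X Z) B. \<forall>D\<in>A. \<forall>f\<in>alg_hom T B D.
        (\<forall>\<sigma>\<in>ops T. \<forall>xs\<in>args T \<sigma> (ob X D).
           \<theta> (D, f, opE X D \<sigma> xs) = opE Z D \<sigma> (map (\<lambda>x. \<theta> (D, f, x)) xs)) \<and>
        (\<forall>r\<in>car D. \<theta> (D, f, str X D r) = str Z D r)},
      act = act (expE T A X Z)\<rparr>"

definition homR_incl :: "('f, 'a) alg \<Rightarrow> ('f, 'a, 'x, 'z) expel \<Rightarrow> ('f, 'a, 'x, 'z) expel" where
  "homR_incl B \<theta> = \<theta>"

definition exp_ralg :: "'f alg_theory \<Rightarrow> ('f, 'a) alg set \<Rightarrow> ('f, 'a, 's, 'm) copsh_scheme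
    \<Rightarrow> ('f, 'a, ('f, 'a, 's, 'a) expel) ralg" where
  "exp_ralg T A S =
     \<lparr>ob = ob (expE T A S R_obj),
      act = act (expE T A S R_obj),
      opE = \<lambda>B \<sigma> \<theta>s. \<lambda>(D, f, s)\<in>exp_dom T A S B. opn D \<sigma> (map (\<lambda>\<theta>. \<theta> (D, f, s)) \<theta>s),
      str = transpose T A R_obj S (\<lambda>B. fst)\<rparr>"

definition dirac :: "'f alg_theory \<Rightarrow> ('f, 'a) alg set \<Rightarrow> ('f, 'a, 'x, 'm) ralg_scheme
    \<Rightarrow> ('f, 'a) alg \<Rightarrow> 'x \<Rightarrow> ('f, 'a, ('f, 'a, 'x, 'a) expel, 'a) expel" where
  "dirac T A X B =
     precompE T A (homR T A X R_ralg) homR_incl B \<circ>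
     transpose T A X (expE T A X R_ralg) evalE B"

section \<open>Universal properties\<close>

text \<open>
  The target algebras below range over arbitrary types, so these are the unrestricted universal
  properties of the concrete constructions above.
\<close>

lemma term_val_closed:
  assumes "\<forall>\<sigma>\<in>ops T. \<forall>xs\<in>args T \<sigma> S. I \<sigma> xs \<in> S" and "t \<in> terms T G" and "\<forall>x\<in>G. v x \<in> S"
  shows "term_val I v t \<in> S"
  using assms(2)
proof induction
  case (Var x)
  then show ?case using assms(3) by simp
next
  case (App \<sigma> ts)
  then have "map (term_val I v) ts \<in> args T \<sigma> S" by (auto simp: args_def)
  with App assms(1) show ?case by simp
qed

lemma term_val_subst: "term_val I v (subst w t) = term_val I (\<lambda>n. term_val I v (w n)) t"
  by (induction t) (simp_all add: comp_def cong: map_cong)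

lemma term_val_cong:
  assumes "t \<in> terms T G" "\<And>x. x \<in> G \<Longrightarrow> v x = w x"
  shows "term_val I v t = term_val I w t"
  using assms(1) by induction (auto simp: assms(2) cong: map_cong)

lemma term_val_hom:
  assumes "\<forall>\<sigma>\<in>ops T. \<forall>xs\<in>args T \<sigma> S. I \<sigma> xs \<in> S"
    and "\<forall>\<sigma>\<in>ops T. \<forall>xs\<in>args T \<sigma> S. h (I \<sigma> xs) = J \<sigma> (map h xs)"
    and "t \<in> terms T G" and "\<forall>x\<in>G. v x \<in> S"
  shows "h (term_val I v t) = term_val J (\<lambda>x. h (v x)) t"
  using assms(3)
proof induction
  case (Var x)
  then show ?case by simp
next
  case (App \<sigma> ts)
  have "map (term_val I v) ts \<in> args T \<sigma> S"
    using App term_val_closed[OF assms(1) _ assms(4)] by (auto simp: args_def)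
  moreover have "map h (map (term_val I v) ts) = map (term_val J (\<lambda>x. h (v x))) ts"
    using App by auto
  ultimately show ?case using App(1) assms(2) by (simp del: map_map)
qed

lemma subst_Var: "subst Var t = t"
  by (induction t) (simp_all add: map_idI)

lemma subst_terms:
  assumes "t \<in> terms T G" and "\<forall>x\<in>G. v x \<in> terms T H"
  shows "subst v t \<in> terms T H"
  by (rule term_val_closed[OF _ assms]) (auto simp: args_def intro: terms.App)

lemma map_trm_subst: "map_trm id h t = subst (\<lambda>x. Var (h x)) t"
  by (induction t) auto

lemma pres_eq_terms:
  assumes "wf_theory T" "E \<subseteq> terms T G \<times> terms T G" "pres_eq T G E s t"
  shows "s \<in> terms T G \<and> t \<in> terms T G"
  using assms(3)
proof induction
  case (ax s t v)
  then have "s \<in> terms T UNIV" "t \<in> terms T UNIV" using assms(1) by (auto simp: wf_theory_def)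
  with ax show ?case by (auto intro!: subst_terms)
next
  case (cong \<sigma> ss ts)
  then show ?case
    by (auto simp: list_all2_conv_all_nth in_set_conv_nth intro!: terms.App)
qed (use assms(2) in auto)

lemma pres_eq_sound:
  assumes T: "wf_theory T" and E: "E \<subseteq> terms T G \<times> terms T G" and K: "is_alg T K"
    and v: "\<forall>x\<in>G. v x \<in> car K"
    and rel: "\<forall>(s, t)\<in>E. term_val (opn K) v s = term_val (opn K) v t"
    and st: "pres_eq T G E s t"
  shows "term_val (opn K) v s = term_val (opn K) v t"
  using st
proof induction
  case (ax s t w)
  have "term_val (opn K) v (w n) \<in> car K" for n
    using K ax v by (intro term_val_closed[of T]) (auto simp: is_alg_def)
  then have "range (\<lambda>n. term_val (opn K) v (w n)) \<subseteq> car K" by auto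
  then show ?case using K ax(1) unfolding is_alg_def term_val_subst by blast
next
  case (cong \<sigma> ss ts)
  then have "map (term_val (opn K) v) ss = map (term_val (opn K) v) ts"
    by (auto simp: list_all2_conv_all_nth intro!: nth_equalityI)
  then show ?case by simp
qed (use rel in auto)

lemma pres_class_eq:
  assumes "t \<in> terms T G"
  shows "pres_class T G E s = pres_class T G E t \<longleftrightarrow> pres_eq T G E s t"
  unfolding pres_class_def using assms by (blast intro: pres_eq.refl pres_eq.sym pres_eq.trans)

lemma pres_alg_opn:
  assumes "\<sigma> \<in> ops T" "length ts = ar T \<sigma>" "set ts \<subseteq> terms T G"
  shows "opn (pres_alg T G E) \<sigma> (map (pres_class T G E) ts) = pres_class T G E (App \<sigma> ts)"
proof -
  have "pres_eq T G E (App \<sigma> us) (App \<sigma> ts)"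
    if "list_all2 (\<in>) us (map (pres_class T G E) ts)" for us
    using that assms
    by (intro pres_eq.cong) (auto simp: list_all2_conv_all_nth pres_class_def)
  moreover have "list_all2 (\<in>) ts (map (pres_class T G E) ts)"
    using assms by (auto simp: list_all2_conv_all_nth pres_class_def in_set_conv_nth subset_iff intro!: pres_eq.refl)
  ultimately show ?thesis
    unfolding pres_alg_def pres_class_def by (auto intro: pres_eq.trans)
qed

lemma pres_reps:
  assumes "set Xs \<subseteq> pres_class T G E ` terms T G"
  obtains ts where "Xs = map (pres_class T G E) ts" "set ts \<subseteq> terms T G"
proof -
  have "\<exists>ts. Xs = map (pres_class T G E) ts \<and> set ts \<subseteq> terms T G"
    using assms
  proof (induction Xs)
    case (Cons X Xs)
    then obtain t ts where "X = pres_class T G E t" "t \<in> terms T G"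
      "Xs = map (pres_class T G E) ts" "set ts \<subseteq> terms T G" by auto
    then show ?case by (intro exI[of _ "t # ts"]) simp
  qed simp
  then show ?thesis using that by blast
qed

lemma pres_term_val:
  assumes "t \<in> terms T H" "\<forall>x\<in>H. w x \<in> terms T G"
  shows "term_val (opn (pres_alg T G E)) (\<lambda>x. pres_class T G E (w x)) t = pres_class T G E (subst w t)"
  using assms(1)
proof induction
  case (App \<sigma> ts)
  have eq: "map (term_val (opn (pres_alg T G E)) (\<lambda>x. pres_class T G E (w x))) ts
     = map (pres_class T G E) (map (subst w) ts)"
    using App by simp
  have "set (map (subst w) ts) \<subseteq> terms T G" using App assms(2) by (auto intro: subst_terms)
  then show ?case
    using App pres_alg_opn[of \<sigma> T "map (subst w) ts" G E] unfolding term_val.simps eq by simp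
qed simp

lemma is_alg_pres_alg:
  assumes T: "wf_theory T"
  shows "is_alg T (pres_alg T G E)"
  unfolding is_alg_def
proof (intro conjI ballI)
  fix \<sigma> Xs assume \<sigma>: "\<sigma> \<in> ops T" and Xs: "Xs \<in> args T \<sigma> (car (pres_alg T G E))"
  then have "set Xs \<subseteq> pres_class T G E ` terms T G" by (simp add: args_def pres_alg_def)
  from pres_reps[OF this] obtain ts where
    ts: "Xs = map (pres_class T G E) ts" "set ts \<subseteq> terms T G" by metis
  moreover have "length ts = ar T \<sigma>" using Xs ts by (auto simp: args_def)
  moreover from this have "App \<sigma> ts \<in> terms T G" using ts \<sigma> by (auto intro: terms.App)
  moreover have "car (pres_alg T G E) = pres_class T G E ` terms T G" by (simp add: pres_alg_def)
  ultimately show "opn (pres_alg T G E) \<sigma> Xs \<in> car (pres_alg T G E)"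
    using pres_alg_opn[OF \<sigma>, of ts G E] by auto
next
  fix e assume e: "e \<in> eqs T"
  obtain s t where st: "e = (s, t)" by fastforce
  then have s: "s \<in> terms T UNIV" and t: "t \<in> terms T UNIV"
    using e T by (auto simp: wf_theory_def)
  have "term_val (opn (pres_alg T G E)) v s = term_val (opn (pres_alg T G E)) v t"
    if v: "range v \<subseteq> car (pres_alg T G E)" for v
  proof -
    have "\<forall>n. \<exists>w. w \<in> terms T G \<and> v n = pres_class T G E w"
      using v by (auto simp: pres_alg_def)
    then obtain w where w: "\<And>n. w n \<in> terms T G" "\<And>n. v n = pres_class T G E (w n)" by metis
    then have v: "v = (\<lambda>n. pres_class T G E (w n))" by auto
    have "pres_eq T G E (subst w s) (subst w t)"
      using e st w by (auto intro: pres_eq.ax)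
    moreover have "subst w t \<in> terms T G" using t w by (auto intro: subst_terms)
    ultimately show ?thesis
      using s t w unfolding v by (simp add: pres_term_val pres_class_eq)
  qed
  then show "case e of (s, t) \<Rightarrow> \<forall>v. range v \<subseteq> car (pres_alg T G E) \<longrightarrow>
    term_val (opn (pres_alg T G E)) v s = term_val (opn (pres_alg T G E)) v t"
    using st by auto
qed

lemma pres_universal:
  assumes T: "wf_theory T" and E: "E \<subseteq> terms T G \<times> terms T G" and K: "is_alg T K"
    and v: "\<forall>x\<in>G. v x \<in> car K"
    and rel: "\<forall>(s, t)\<in>E. term_val (opn K) v s = term_val (opn K) v t"
  shows "\<exists>!h. h \<in> alg_hom T (pres_alg T G E) K \<and> (\<forall>x\<in>G. h (pres_class T G E (Var x)) = v x)"
proof -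
  let ?I = "pres_alg T G E"
  let ?c = "pres_class T G E"
  define h where "h = (\<lambda>X\<in>car ?I. term_val (opn K) v (SOME t. t \<in> X))"
  have hc: "h (?c t) = term_val (opn K) v t" if t: "t \<in> terms T G" for t
  proof -
    have "t \<in> ?c t" using t by (simp add: pres_class_def pres_eq.refl)
    then have "(SOME s. s \<in> ?c t) \<in> ?c t" by (rule someI)
    then have "pres_eq T G E (SOME s. s \<in> ?c t) t" by (simp add: pres_class_def)
    from pres_eq_sound[OF T E K v rel this] show ?thesis
      using t by (simp add: h_def pres_alg_def)
  qed
  have Kc: "\<forall>\<sigma>\<in>ops T. \<forall>xs\<in>args T \<sigma> (car K). opn K \<sigma> xs \<in> car K" using K by (simp add: is_alg_def)
  have ops: "h (opn ?I \<sigma> Xs) = opn K \<sigma> (map h Xs)"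
    if \<sigma>: "\<sigma> \<in> ops T" and Xs: "Xs \<in> args T \<sigma> (car ?I)" for \<sigma> Xs
  proof -
    have "set Xs \<subseteq> ?c ` terms T G" using Xs by (simp add: args_def pres_alg_def)
    from pres_reps[OF this] obtain ts where ts: "Xs = map ?c ts" "set ts \<subseteq> terms T G" by metis
    have l: "length ts = ar T \<sigma>" using Xs ts by (auto simp: args_def)
    then have "App \<sigma> ts \<in> terms T G" using ts \<sigma> by (auto intro: terms.App)
    moreover have "map h Xs = map (term_val (opn K) v) ts" using ts hc by auto
    ultimately show ?thesis
      using pres_alg_opn[OF \<sigma> l ts(2), of E] hc by (simp add: ts(1) del: map_map)
  qed
  have "h \<in> car ?I \<rightarrow>\<^sub>E car K"
  proof
    fix X assume "X \<in> car ?I"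
    then obtain t where "X = ?c t" "t \<in> terms T G" by (auto simp: pres_alg_def)
    then show "h X \<in> car K" using hc term_val_closed[OF Kc _ v] by simp
  qed (simp add: h_def)
  then have h: "h \<in> alg_hom T ?I K" using ops by (simp add: alg_hom_def)
  moreover have "\<forall>x\<in>G. h (?c (Var x)) = v x" using hc by (simp add: terms.Var)
  moreover have "k = h" if k: "k \<in> alg_hom T ?I K" and kv: "\<forall>x\<in>G. k (?c (Var x)) = v x" for k
  proof (rule extensionalityI[of _ "car ?I"])
    fix X assume "X \<in> car ?I"
    then obtain t where X: "X = ?c t" and t: "t \<in> terms T G"
      by (auto simp: pres_alg_def)
    from t have "k (?c t) = term_val (opn K) v t"
    proof induction
      case (App \<sigma> ts)
      have l: "length ts = ar T \<sigma>" "set ts \<subseteq> terms T G" using App by auto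
      have "map ?c ts \<in> args T \<sigma> (car ?I)"
        using l by (auto simp: args_def pres_alg_def)
      then have "k (opn ?I \<sigma> (map ?c ts)) = opn K \<sigma> (map k (map ?c ts))"
        using k App(1) unfolding alg_hom_def by blast
      moreover have "map k (map ?c ts) = map (term_val (opn K) v) ts" using App by auto
      ultimately show ?case using pres_alg_opn[OF App(1) l, of E] by (simp del: map_map)
    qed (simp add: kv)
    then show "k X = h X" using X hc t by simp
  qed (use k h in \<open>auto simp: alg_hom_def PiE_def\<close>)
  ultimately show ?thesis by blast
qed

lemma pres_hom_val:
  assumes T: "wf_theory T" and u: "u \<in> alg_hom T (pres_alg T G E) K" and t: "t \<in> terms T G"
  shows "u (pres_class T G E t) = term_val (opn K) (\<lambda>x. u (pres_class T G E (Var x))) t"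
proof -
  let ?P = "pres_alg T G E"
  have "u (term_val (opn ?P) (\<lambda>x. pres_class T G E (Var x)) t) =
      term_val (opn K) (\<lambda>x. u (pres_class T G E (Var x))) t"
  proof (rule term_val_hom[OF _ _ t])
    show "\<forall>\<sigma>\<in>ops T. \<forall>xs\<in>args T \<sigma> (car ?P). opn ?P \<sigma> xs \<in> car ?P"
      using is_alg_pres_alg[OF T, of G E] by (simp add: is_alg_def)
    show "\<forall>\<sigma>\<in>ops T. \<forall>xs\<in>args T \<sigma> (car ?P). u (opn ?P \<sigma> xs) = opn K \<sigma> (map u xs)"
      using u by (simp add: alg_hom_def)
    show "\<forall>x\<in>G. pres_class T G E (Var x) \<in> car ?P"
      by (auto simp: pres_alg_def intro!: imageI terms.Var)
  qed
  then show ?thesis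
    using pres_term_val[OF t, of Var G E] by (simp add: terms.Var subst_Var)
qed

lemma initial_universal:
  assumes "wf_theory T" and "is_alg T K"
  shows "\<exists>!h. h \<in> alg_hom T (initial_alg T) K"
  using pres_universal[OF assms(1) _ assms(2), where G = "{}" and E = "{}"] by (simp add: initial_alg_def)

lemma coprod_rels_terms:
  assumes "is_alg T M" "is_alg T N"
  shows "coprod_rels T M N \<subseteq> terms T (car M <+> car N) \<times> terms T (car M <+> car N)"
  using assms by (fastforce simp: coprod_rels_def args_def is_alg_def intro!: terms.intros)

lemma is_alg_coprod:
  assumes "wf_theory T"
  shows "is_alg T (alg_coprod T M N)"
  using assms by (simp add: alg_coprod_def is_alg_pres_alg)

lemma alg_inl_hom:
  assumes "is_alg T M"
  shows "alg_inl T M N \<in> alg_hom T M (alg_coprod T M N)"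
proof -
  let ?G = "car M <+> car N" and ?E = "coprod_rels T M N"
  have "alg_inl T M N (opn M \<sigma> xs) = opn (alg_coprod T M N) \<sigma> (map (alg_inl T M N) xs)"
    if \<sigma>: "\<sigma> \<in> ops T" and xs: "xs \<in> args T \<sigma> (car M)" for \<sigma> xs
  proof -
    let ?ts = "map (\<lambda>x. Var (Inl x)) xs"
    have c: "opn M \<sigma> xs \<in> car M" using assms \<sigma> xs by (simp add: is_alg_def)
    have "(App \<sigma> ?ts, Var (Inl (opn M \<sigma> xs))) \<in> ?E"
      using \<sigma> xs by (auto simp: coprod_rels_def)
    then have "pres_class T ?G ?E (App \<sigma> ?ts) = pres_class T ?G ?E (Var (Inl (opn M \<sigma> xs)))"
      using c by (subst pres_class_eq) (auto intro: pres_eq.rel terms.Var)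
    moreover have "opn (alg_coprod T M N) \<sigma> (map (pres_class T ?G ?E) ?ts)
        = pres_class T ?G ?E (App \<sigma> ?ts)"
      unfolding alg_coprod_def using \<sigma> xs
      by (intro pres_alg_opn) (auto simp: args_def intro!: terms.Var)
    moreover have "map (pres_class T ?G ?E) ?ts = map (alg_inl T M N) xs"
      using xs by (auto simp: alg_inl_def coprod_class_def args_def)
    ultimately have "opn (alg_coprod T M N) \<sigma> (map (alg_inl T M N) xs)
        = pres_class T ?G ?E (Var (Inl (opn M \<sigma> xs)))"
      by metis
    then show ?thesis using c by (simp add: alg_inl_def coprod_class_def)
  qed
  moreover have "alg_inl T M N \<in> car M \<rightarrow>\<^sub>E car (alg_coprod T M N)"
    by (auto simp: alg_inl_def coprod_class_def alg_coprod_def pres_alg_def intro!: imageI terms.Var)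
  ultimately show ?thesis by (simp add: alg_hom_def)
qed

lemma alg_inr_hom:
  assumes "is_alg T N"
  shows "alg_inr T M N \<in> alg_hom T N (alg_coprod T M N)"
proof -
  let ?G = "car M <+> car N" and ?E = "coprod_rels T M N"
  have "alg_inr T M N (opn N \<sigma> xs) = opn (alg_coprod T M N) \<sigma> (map (alg_inr T M N) xs)"
    if \<sigma>: "\<sigma> \<in> ops T" and xs: "xs \<in> args T \<sigma> (car N)" for \<sigma> xs
  proof -
    let ?ts = "map (\<lambda>x. Var (Inr x)) xs"
    have c: "opn N \<sigma> xs \<in> car N" using assms \<sigma> xs by (simp add: is_alg_def)
    have "(App \<sigma> ?ts, Var (Inr (opn N \<sigma> xs))) \<in> ?E"
      using \<sigma> xs by (auto simp: coprod_rels_def)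
    then have "pres_class T ?G ?E (App \<sigma> ?ts) = pres_class T ?G ?E (Var (Inr (opn N \<sigma> xs)))"
      using c by (subst pres_class_eq) (auto intro: pres_eq.rel terms.Var)
    moreover have "opn (alg_coprod T M N) \<sigma> (map (pres_class T ?G ?E) ?ts)
        = pres_class T ?G ?E (App \<sigma> ?ts)"
      unfolding alg_coprod_def using \<sigma> xs
      by (intro pres_alg_opn) (auto simp: args_def intro!: terms.Var)
    moreover have "map (pres_class T ?G ?E) ?ts = map (alg_inr T M N) xs"
      using xs by (auto simp: alg_inr_def coprod_class_def args_def)
    ultimately have "opn (alg_coprod T M N) \<sigma> (map (alg_inr T M N) xs)
        = pres_class T ?G ?E (Var (Inr (opn N \<sigma> xs)))"
      by metis
    then show ?thesis using c by (simp add: alg_inr_def coprod_class_def)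
  qed
  moreover have "alg_inr T M N \<in> car N \<rightarrow>\<^sub>E car (alg_coprod T M N)"
    by (auto simp: alg_inr_def coprod_class_def alg_coprod_def pres_alg_def intro!: imageI terms.Var)
  ultimately show ?thesis by (simp add: alg_hom_def)
qed

lemma coprod_universal:
  assumes T: "wf_theory T" and M: "is_alg T M" and N: "is_alg T N" and K: "is_alg T K"
    and h: "h \<in> alg_hom T M K" and k: "k \<in> alg_hom T N K"
  shows "\<exists>!u. u \<in> alg_hom T (alg_coprod T M N) K \<and>
    (\<forall>x\<in>car M. u (alg_inl T M N x) = h x) \<and> (\<forall>y\<in>car N. u (alg_inr T M N y) = k y)"
proof -
  have "\<forall>x\<in>car M <+> car N. case_sum h k x \<in> car K"
    using h k by (auto simp: alg_hom_def)
  moreover have "\<forall>(s, t)\<in>coprod_rels T M N.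
      term_val (opn K) (case_sum h k) s = term_val (opn K) (case_sum h k) t"
    using h k by (auto simp: coprod_rels_def alg_hom_def comp_def)
  ultimately have "\<exists>!u. u \<in> alg_hom T (alg_coprod T M N) K \<and>
    (\<forall>x\<in>car M <+> car N. u (coprod_class T M N (Var x)) = case_sum h k x)"
    unfolding alg_coprod_def coprod_class_def
    by (rule pres_universal[OF T coprod_rels_terms[OF M N] K])
  moreover have "(\<forall>x\<in>car M <+> car N. u (coprod_class T M N (Var x)) = case_sum h k x) \<longleftrightarrow>
    (\<forall>x\<in>car M. u (alg_inl T M N x) = h x) \<and> (\<forall>y\<in>car N. u (alg_inr T M N y) = k y)" for u
    by (simp add: alg_inl_def alg_inr_def Plus_def ball_Un)
  ultimately show ?thesis by simp
qed

text \<open>\<open>X \<otimes> Y\<close> is the coproduct of \<open>X\<close> and \<open>Y\<close> among the algebra objects of the topos.\<close>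

lemma is_functorD:
  assumes "is_functor T A F"
  shows "B \<in> A \<Longrightarrow> D \<in> A \<Longrightarrow> f \<in> alg_hom T B D \<Longrightarrow> x \<in> ob F B \<Longrightarrow> act F B D f x \<in> ob F D"
    and "B \<in> A \<Longrightarrow> x \<in> ob F B \<Longrightarrow> act F B B (alg_id B) x = x"
    and "B \<in> A \<Longrightarrow> D \<in> A \<Longrightarrow> E \<in> A \<Longrightarrow> f \<in> alg_hom T B D \<Longrightarrow> g \<in> alg_hom T D E \<Longrightarrow> x \<in> ob F B
      \<Longrightarrow> act F B E (compose (car B) g f) x = act F D E g (act F B D f x)"
  using assms by (auto simp: is_functor_def)

lemma tensorE_ob: "ob (tensorE T X Y) B =
    coprod_class T (alg_at X B) (alg_at Y B) ` terms T (ob X B <+> ob Y B)"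
  by (simp add: tensorE_def alg_coprod_def pres_alg_def coprod_class_def alg_at_def)

lemma tensorE_act:
  assumes T: "wf_theory T" and X: "is_talg T A X" and Y: "is_talg T A Y"
    and B: "B \<in> A" and D: "D \<in> A" and f: "f \<in> alg_hom T B D"
  shows "t \<in> terms T (ob X B <+> ob Y B) \<Longrightarrow> act (tensorE T X Y) B D f (coprod_class T (alg_at X B) (alg_at Y B) t) =
    coprod_class T (alg_at X D) (alg_at Y D)
      (subst (\<lambda>x. Var (map_sum (act X B D f) (act Y B D f) x)) t)"
    and "\<exists>u\<in>alg_hom T (alg_coprod T (alg_at X B) (alg_at Y B)) (alg_coprod T (alg_at X D) (alg_at Y D)).
      \<forall>U\<in>ob (tensorE T X Y) B. act (tensorE T X Y) B D f U = u U"
proof -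
  let ?M = "alg_at X B" and ?N = "alg_at Y B" and ?M' = "alg_at X D" and ?N' = "alg_at Y D"
  let ?G = "car ?M <+> car ?N" and ?G' = "car ?M' <+> car ?N'"
  let ?E = "coprod_rels T ?M ?N" and ?E' = "coprod_rels T ?M' ?N'"
  let ?m = "map_sum (act X B D f) (act Y B D f)"
  let ?K = "alg_coprod T ?M' ?N'"
  have alg: "is_alg T ?M" "is_alg T ?N" "is_alg T ?M'" "is_alg T ?N'"
    using X Y B D by (auto simp: is_talg_def)
  have K: "is_alg T ?K" by (rule is_alg_coprod[OF T])
  have Xf: "act X B D f x \<in> ob X D" if "x \<in> ob X B" for x
    using X B D f that by (auto simp: is_talg_def dest: is_functorD(1))
  have Yf: "act Y B D f y \<in> ob Y D" if "y \<in> ob Y B" for y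
    using Y B D f that by (auto simp: is_talg_def dest: is_functorD(1))
  have m: "\<forall>x\<in>?G. Var (?m x) \<in> terms T ?G'"
    using Xf Yf by (auto simp: alg_at_def intro!: terms.Var)
  let ?v = "\<lambda>x. coprod_class T ?M' ?N' (Var (?m x))"
  have vK: "\<forall>x\<in>?G. ?v x \<in> car ?K"
    using m by (auto simp: alg_coprod_def pres_alg_def coprod_class_def)
  have val: "term_val (opn ?K) ?v s = coprod_class T ?M' ?N' (subst (\<lambda>x. Var (?m x)) s)"
    if "s \<in> terms T ?G" for s
    using pres_term_val[OF that m] by (simp add: alg_coprod_def coprod_class_def)
  have rel: "\<forall>(s, t)\<in>?E. term_val (opn ?K) ?v s = term_val (opn ?K) ?v t"
  proof clarify
    fix s t assume "(s, t) \<in> ?E"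
    then consider
        (l) \<sigma> xs where "\<sigma> \<in> ops T" "xs \<in> args T \<sigma> (ob X B)"
          "s = App \<sigma> (map (\<lambda>x. Var (Inl x)) xs)" "t = Var (Inl (opE X B \<sigma> xs))"
      | (r) \<sigma> xs where "\<sigma> \<in> ops T" "xs \<in> args T \<sigma> (ob Y B)"
          "s = App \<sigma> (map (\<lambda>x. Var (Inr x)) xs)" "t = Var (Inr (opE Y B \<sigma> xs))"
      by (auto simp: coprod_rels_def alg_at_def)
    then show "term_val (opn ?K) ?v s = term_val (opn ?K) ?v t"
    proof cases
      case l
      have xs: "map (act X B D f) xs \<in> args T \<sigma> (car ?M')"
        using l Xf by (auto simp: args_def alg_at_def)
      have "map (\<lambda>x. ?v (Inl x)) xs = map (alg_inl T ?M' ?N') (map (act X B D f) xs)"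
        using xs by (auto simp: alg_inl_def args_def)
      moreover have "opn ?K \<sigma> (map (alg_inl T ?M' ?N') (map (act X B D f) xs))
          = alg_inl T ?M' ?N' (opn ?M' \<sigma> (map (act X B D f) xs))"
        using alg_inl_hom[OF alg(3), of ?N'] l(1) xs unfolding alg_hom_def by simp
      moreover have "opn ?M' \<sigma> (map (act X B D f) xs) = act X B D f (opE X B \<sigma> xs)"
        using X B D f l by (simp add: is_talg_def alg_at_def)
      moreover have "opn ?M' \<sigma> (map (act X B D f) xs) \<in> car ?M'"
        using alg(3) l(1) xs by (simp add: is_alg_def)
      moreover have "term_val (opn ?K) ?v s = opn ?K \<sigma> (map (\<lambda>x. ?v (Inl x)) xs)"
        by (simp add: l(3) comp_def)
      ultimately have "term_val (opn ?K) ?v s = alg_inl T ?M' ?N' (act X B D f (opE X B \<sigma> xs))"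
          "act X B D f (opE X B \<sigma> xs) \<in> car ?M'"
        by metis+
      then show ?thesis by (simp add: l(4) alg_inl_def)
    next
      case r
      have xs: "map (act Y B D f) xs \<in> args T \<sigma> (car ?N')"
        using r Yf by (auto simp: args_def alg_at_def)
      have "map (\<lambda>x. ?v (Inr x)) xs = map (alg_inr T ?M' ?N') (map (act Y B D f) xs)"
        using xs by (auto simp: alg_inr_def args_def)
      moreover have "opn ?K \<sigma> (map (alg_inr T ?M' ?N') (map (act Y B D f) xs))
          = alg_inr T ?M' ?N' (opn ?N' \<sigma> (map (act Y B D f) xs))"
        using alg_inr_hom[OF alg(4), of ?M'] r(1) xs unfolding alg_hom_def by simp
      moreover have "opn ?N' \<sigma> (map (act Y B D f) xs) = act Y B D f (opE Y B \<sigma> xs)"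
        using Y B D f r by (simp add: is_talg_def alg_at_def)
      moreover have "opn ?N' \<sigma> (map (act Y B D f) xs) \<in> car ?N'"
        using alg(4) r(1) xs by (simp add: is_alg_def)
      moreover have "term_val (opn ?K) ?v s = opn ?K \<sigma> (map (\<lambda>x. ?v (Inr x)) xs)"
        by (simp add: r(3) comp_def)
      ultimately have "term_val (opn ?K) ?v s = alg_inr T ?M' ?N' (act Y B D f (opE Y B \<sigma> xs))"
          "act Y B D f (opE Y B \<sigma> xs) \<in> car ?N'"
        by metis+
      then show ?thesis by (simp add: r(4) alg_inr_def)
    qed
  qed
  note E = coprod_rels_terms[OF alg(1,2)]
  have act: "act (tensorE T X Y) B D f (coprod_class T ?M ?N t) = term_val (opn ?K) ?v t"
    if t: "t \<in> terms T ?G" for t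
  proof -
    have "coprod_class T ?M' ?N' (map_trm id ?m s) = term_val (opn ?K) ?v t"
      if "s \<in> coprod_class T ?M ?N t" for s
    proof -
      have st: "pres_eq T ?G ?E s t" using that by (simp add: coprod_class_def pres_class_def)
      then have "s \<in> terms T ?G" using pres_eq_terms[OF T E] by blast
      then show ?thesis
        using pres_eq_sound[OF T E K vK rel st] val by (simp add: map_trm_subst)
    qed
    moreover have "t \<in> coprod_class T ?M ?N t"
      using t by (simp add: coprod_class_def pres_class_def pres_eq.refl)
    ultimately show ?thesis unfolding tensorE_def by auto
  qed
  show "act (tensorE T X Y) B D f (coprod_class T ?M ?N t) =
    coprod_class T ?M' ?N' (subst (\<lambda>x. Var (?m x)) t)" if "t \<in> terms T (ob X B <+> ob Y B)"
    using act[of t] val[of t] that by (simp add: alg_at_def)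
  obtain u where u: "u \<in> alg_hom T (alg_coprod T ?M ?N) ?K"
    and uv: "\<forall>x\<in>?G. u (coprod_class T ?M ?N (Var x)) = ?v x"
    using pres_universal[OF T E K vK rel] unfolding alg_coprod_def coprod_class_def by blast
  have "act (tensorE T X Y) B D f U = u U" if U: "U \<in> ob (tensorE T X Y) B" for U
  proof -
    obtain t where t: "t \<in> terms T ?G" "U = coprod_class T ?M ?N t"
      using U by (auto simp: tensorE_ob alg_at_def)
    have "u U = term_val (opn ?K) (\<lambda>x. u (coprod_class T ?M ?N (Var x))) t"
      using pres_hom_val[OF T _ t(1)] u t(2) unfolding alg_coprod_def coprod_class_def by blast
    also have "\<dots> = term_val (opn ?K) ?v t"
      using t(1) uv by (intro term_val_cong) auto
    finally show ?thesis using t act[OF t(1)] by simp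
  qed
  then show "\<exists>u\<in>alg_hom T (alg_coprod T ?M ?N) ?K.
      \<forall>U\<in>ob (tensorE T X Y) B. act (tensorE T X Y) B D f U = u U"
    using u by blast
qed

lemma alg_at_tensorE: "alg_at (tensorE T X Y) B = alg_coprod T (alg_at X B) (alg_at Y B)"
  by (simp add: alg_at_def tensorE_def)

lemma alg_id_hom: "is_alg T B \<Longrightarrow> alg_id B \<in> alg_hom T B B"
  by (auto simp: alg_hom_def alg_id_def is_alg_def args_def map_idI subset_iff)

lemma alg_hom_compose:
  assumes "is_alg T B" and f: "f \<in> alg_hom T B D" and g: "g \<in> alg_hom T D E"
  shows "compose (car B) g f \<in> alg_hom T B E"
proof -
  have "compose (car B) g f (opn B \<sigma> xs) = opn E \<sigma> (map (compose (car B) g f) xs)"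
    if \<sigma>: "\<sigma> \<in> ops T" and xs: "xs \<in> args T \<sigma> (car B)" for \<sigma> xs
  proof -
    have "map f xs \<in> args T \<sigma> (car D)" using f xs by (auto simp: args_def alg_hom_def)
    then have "g (f (opn B \<sigma> xs)) = opn E \<sigma> (map g (map f xs))"
      using f g \<sigma> xs by (simp add: alg_hom_def del: map_map)
    moreover have "map (compose (car B) g f) xs = map g (map f xs)"
      using xs by (auto simp: args_def compose_def)
    moreover have "opn B \<sigma> xs \<in> car B" using assms(1) \<sigma> xs by (simp add: is_alg_def)
    ultimately show ?thesis by (simp add: compose_def del: map_map)
  qed
  moreover have "compose (car B) g f \<in> car B \<rightarrow>\<^sub>E car E"
    using f g by (auto simp: alg_hom_def compose_def)
  ultimately show ?thesis by (simp add: alg_hom_def)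
qed

lemma is_talg_tensorE:
  assumes T: "wf_theory T" and A: "\<forall>M\<in>A. is_alg T M" and X: "is_talg T A X" and Y: "is_talg T A Y"
  shows "is_talg T A (tensorE T X Y)"
proof -
  let ?Z = "tensorE T X Y"
  let ?c = "\<lambda>B. coprod_class T (alg_at X B) (alg_at Y B)"
  let ?m = "\<lambda>B D f. map_sum (act X B D f) (act Y B D f)"
  let ?G = "\<lambda>B. ob X B <+> ob Y B"
  have XY: "is_functor T A X" "is_functor T A Y" using X Y by (auto simp: is_talg_def)
  have u: "\<exists>u\<in>alg_hom T (alg_at ?Z B) (alg_at ?Z D). \<forall>U\<in>ob ?Z B. act ?Z B D f U = u U"
    if "B \<in> A" "D \<in> A" "f \<in> alg_hom T B D" for B D f
    unfolding alg_at_tensorE by (rule tensorE_act(2)[OF T X Y that])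
  have m: "?m B D f x \<in> ?G D" if "B \<in> A" "D \<in> A" "f \<in> alg_hom T B D" "x \<in> ?G B" for B D f x
    using that XY[THEN is_functorD(1)] by auto
  have Zf: "act ?Z B D f U \<in> ob ?Z D" if "B \<in> A" "D \<in> A" "f \<in> alg_hom T B D" "U \<in> ob ?Z B" for B D f U
    using u[OF that(1-3)] that(4) by (auto simp: alg_hom_def alg_at_def)
  have "act ?Z B B (alg_id B) U = U" if B: "B \<in> A" and U: "U \<in> ob ?Z B" for B U
  proof -
    have id: "alg_id B \<in> alg_hom T B B" using A B by (simp add: alg_id_hom)
    obtain t where t: "t \<in> terms T (?G B)" "U = ?c B t" using U by (auto simp: tensorE_ob)
    have "subst (\<lambda>x. Var (?m B B (alg_id B) x)) t = subst Var t"
      using t(1) XY[THEN is_functorD(2)] B by (intro term_val_cong) auto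
    then show ?thesis using tensorE_act(1)[OF T X Y B B id t(1)] t(2) by (simp add: subst_Var)
  qed
  moreover have "act ?Z B E (compose (car B) g f) U = act ?Z D E g (act ?Z B D f U)"
    if B: "B \<in> A" and D: "D \<in> A" and E: "E \<in> A" and f: "f \<in> alg_hom T B D" and g: "g \<in> alg_hom T D E"
      and U: "U \<in> ob ?Z B" for B D E f g U
  proof -
    have gf: "compose (car B) g f \<in> alg_hom T B E" using A B f g by (simp add: alg_hom_compose)
    obtain t where t: "t \<in> terms T (?G B)" "U = ?c B t" using U by (auto simp: tensorE_ob)
    have t': "subst (\<lambda>x. Var (?m B D f x)) t \<in> terms T (?G D)"
      using t(1) m[OF B D f] by (intro subst_terms) (auto intro!: terms.Var)
    have "subst (\<lambda>x. Var (?m B E (compose (car B) g f) x)) t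
        = subst (\<lambda>x. Var (?m D E g (?m B D f x))) t"
      using t(1) XY[THEN is_functorD(3), OF B D E f g] by (intro term_val_cong) auto
    then show ?thesis
      using tensorE_act(1)[OF T X Y B E gf t(1)] tensorE_act(1)[OF T X Y B D f t(1)]
        tensorE_act(1)[OF T X Y D E g t'] t(2)
      by (simp add: term_val_subst)
  qed
  moreover have "act ?Z B D f (opE ?Z B \<sigma> Us) = opE ?Z D \<sigma> (map (act ?Z B D f) Us)"
    if BDf: "B \<in> A" "D \<in> A" "f \<in> alg_hom T B D" and \<sigma>: "\<sigma> \<in> ops T"
      and Us: "Us \<in> args T \<sigma> (ob ?Z B)" for B D f \<sigma> Us
  proof -
    obtain u where u: "u \<in> alg_hom T (alg_at ?Z B) (alg_at ?Z D)" "\<forall>U\<in>ob ?Z B. act ?Z B D f U = u U"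
      using u[OF BDf] by blast
    have "is_alg T (alg_at ?Z B)" unfolding alg_at_tensorE by (rule is_alg_coprod[OF T])
    then have "opE ?Z B \<sigma> Us \<in> ob ?Z B" using \<sigma> Us by (simp add: is_alg_def alg_at_def)
    moreover have "map (act ?Z B D f) Us = map u Us" using Us u by (auto simp: args_def)
    moreover have "u (opE ?Z B \<sigma> Us) = opE ?Z D \<sigma> (map u Us)"
      using u(1) \<sigma> Us by (simp add: alg_hom_def alg_at_def)
    ultimately show ?thesis using u(2) by metis
  qed
  ultimately show ?thesis
    using Zf is_alg_coprod[OF T] unfolding is_talg_def is_functor_def alg_at_tensorE by auto
qed

lemma inlE_inrE_mor:
  assumes T: "wf_theory T" and X: "is_talg T A X" and Y: "is_talg T A Y"
  shows "talg_mor T A X (tensorE T X Y) (inlE T X Y)" and "talg_mor T A Y (tensorE T X Y) (inrE T X Y)"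
proof -
  let ?Z = "tensorE T X Y"
  have alg: "is_alg T (alg_at X B)" "is_alg T (alg_at Y B)" if "B \<in> A" for B
    using X Y that by (auto simp: is_talg_def)
  have l: "inlE T X Y B \<in> ob X B \<rightarrow> ob ?Z B"
      "\<forall>\<sigma>\<in>ops T. \<forall>xs\<in>args T \<sigma> (ob X B). inlE T X Y B (opE X B \<sigma> xs) = opE ?Z B \<sigma> (map (inlE T X Y B) xs)"
    and r: "inrE T X Y B \<in> ob Y B \<rightarrow> ob ?Z B"
      "\<forall>\<sigma>\<in>ops T. \<forall>xs\<in>args T \<sigma> (ob Y B). inrE T X Y B (opE Y B \<sigma> xs) = opE ?Z B \<sigma> (map (inrE T X Y B) xs)"
    if "B \<in> A" for B
    using alg_inl_hom[OF alg(1)[OF that], of "alg_at Y B"] alg_inr_hom[OF alg(2)[OF that], of "alg_at X B"]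
    unfolding alg_at_tensorE[symmetric]
    by (auto simp: alg_hom_def inlE_def inrE_def alg_at_def PiE_def)
  have XY: "is_functor T A X" "is_functor T A Y" using X Y by (auto simp: is_talg_def)
  have "inlE T X Y D (act X B D f x) = act ?Z B D f (inlE T X Y B x)"
    if "B \<in> A" "D \<in> A" "f \<in> alg_hom T B D" "x \<in> ob X B" for B D f x
    using that XY(1)[THEN is_functorD(1)] tensorE_act(1)[OF T X Y that(1-3), of "Var (Inl x)"]
      terms.Var[of "Inl x" "ob X B <+> ob Y B" T]
    by (simp add: inlE_def alg_inl_def alg_at_def InlI InrI)
  then show "talg_mor T A X ?Z (inlE T X Y)"
    using l by (auto simp: talg_mor_def is_nat_def)
  have "inrE T X Y D (act Y B D f x) = act ?Z B D f (inrE T X Y B x)"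
    if "B \<in> A" "D \<in> A" "f \<in> alg_hom T B D" "x \<in> ob Y B" for B D f x
    using that XY(2)[THEN is_functorD(1)] tensorE_act(1)[OF T X Y that(1-3), of "Var (Inr x)"]
      terms.Var[of "Inr x" "ob X B <+> ob Y B" T]
    by (simp add: inrE_def alg_inr_def alg_at_def InlI InrI)
  then show "talg_mor T A Y ?Z (inrE T X Y)"
    using r by (auto simp: talg_mor_def is_nat_def)
qed

lemma talg_mor_at:
  assumes "is_talg T A X" "talg_mor T A X Z \<phi>" "B \<in> A"
  shows "restrict (\<phi> B) (ob X B) \<in> alg_hom T (alg_at X B) (alg_at Z B)"
proof -
  have "restrict (\<phi> B) (ob X B) (opE X B \<sigma> xs) = opE Z B \<sigma> (map (restrict (\<phi> B) (ob X B)) xs)"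
    if \<sigma>: "\<sigma> \<in> ops T" and xs: "xs \<in> args T \<sigma> (ob X B)" for \<sigma> xs
  proof -
    have "opE X B \<sigma> xs \<in> ob X B"
      using assms \<sigma> xs by (auto simp: is_talg_def is_alg_def alg_at_def)
    moreover have "map (restrict (\<phi> B) (ob X B)) xs = map (\<phi> B) xs"
      using xs by (intro map_cong) (auto simp: args_def)
    moreover have "\<phi> B (opE X B \<sigma> xs) = opE Z B \<sigma> (map (\<phi> B) xs)"
      using assms \<sigma> xs by (simp add: talg_mor_def)
    ultimately show ?thesis by (metis restrict_apply')
  qed
  then show ?thesis using assms by (auto simp: alg_hom_def alg_at_def talg_mor_def is_nat_def)
qed

lemma tensorE_universal:
  assumes T: "wf_theory T" and A: "\<forall>M\<in>A. is_alg T M"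
    and X: "is_talg T A X" and Y: "is_talg T A Y" and Z: "is_talg T A Z"
    and \<phi>: "talg_mor T A X Z \<phi>" and \<psi>: "talg_mor T A Y Z \<psi>"
  obtains \<chi> where "talg_mor T A (tensorE T X Y) Z \<chi>"
    and "\<And>B x. B \<in> A \<Longrightarrow> x \<in> ob X B \<Longrightarrow> \<chi> B (inlE T X Y B x) = \<phi> B x"
    and "\<And>B y. B \<in> A \<Longrightarrow> y \<in> ob Y B \<Longrightarrow> \<chi> B (inrE T X Y B y) = \<psi> B y"
    and "\<And>\<chi>' B u. talg_mor T A (tensorE T X Y) Z \<chi>' \<Longrightarrow>
      (\<And>B x. B \<in> A \<Longrightarrow> x \<in> ob X B \<Longrightarrow> \<chi>' B (inlE T X Y B x) = \<phi> B x) \<Longrightarrow>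
      (\<And>B y. B \<in> A \<Longrightarrow> y \<in> ob Y B \<Longrightarrow> \<chi>' B (inrE T X Y B y) = \<psi> B y) \<Longrightarrow>
      B \<in> A \<Longrightarrow> u \<in> ob (tensorE T X Y) B \<Longrightarrow> \<chi>' B u = \<chi> B u"
proof -
  let ?P = "tensorE T X Y"
  let ?c = "\<lambda>B. coprod_class T (alg_at X B) (alg_at Y B)"
  let ?G = "\<lambda>B. ob X B <+> ob Y B"
  let ?v = "\<lambda>B. case_sum (\<phi> B) (\<psi> B)"
  have alg: "is_alg T (alg_at X B)" "is_alg T (alg_at Y B)" "is_alg T (alg_at Z B)" if "B \<in> A" for B
    using X Y Z that by (auto simp: is_talg_def)
  note P = is_talg_tensorE[OF T A X Y]
  have val: "u (?c B t) = term_val (opE Z B) (?v B) t"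
    if B: "B \<in> A" and u: "u \<in> alg_hom T (alg_at ?P B) (alg_at Z B)"
      and ul: "\<And>x. x \<in> ob X B \<Longrightarrow> u (inlE T X Y B x) = \<phi> B x"
      and ur: "\<And>y. y \<in> ob Y B \<Longrightarrow> u (inrE T X Y B y) = \<psi> B y"
      and t: "t \<in> terms T (?G B)" for B u t
  proof -
    have "u (?c B t) = term_val (opE Z B) (\<lambda>x. u (?c B (Var x))) t"
      using pres_hom_val[OF T, of u "?G B" "coprod_rels T (alg_at X B) (alg_at Y B)" "alg_at Z B" t] u t
      by (simp add: alg_at_tensorE alg_coprod_def coprod_class_def) (simp add: alg_at_def)
    also have "\<dots> = term_val (opE Z B) (?v B) t"
      using t ul ur
      by (intro term_val_cong) (auto simp: inlE_def inrE_def alg_inl_def alg_inr_def alg_at_def)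
    finally show ?thesis .
  qed
  have ex: "\<exists>u. u \<in> alg_hom T (alg_at ?P B) (alg_at Z B) \<and>
      (\<forall>x\<in>ob X B. u (inlE T X Y B x) = \<phi> B x) \<and> (\<forall>y\<in>ob Y B. u (inrE T X Y B y) = \<psi> B y)"
    if B: "B \<in> A" for B
    using coprod_universal[OF T alg[OF B] talg_mor_at[OF X \<phi> B] talg_mor_at[OF Y \<psi> B]]
    unfolding alg_at_tensorE by (auto simp: inlE_def inrE_def alg_at_def)
  obtain \<chi> where \<chi>: "\<And>B. B \<in> A \<Longrightarrow> \<chi> B \<in> alg_hom T (alg_at ?P B) (alg_at Z B)"
    and \<chi>l: "\<And>B x. B \<in> A \<Longrightarrow> x \<in> ob X B \<Longrightarrow> \<chi> B (inlE T X Y B x) = \<phi> B x"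
    and \<chi>r: "\<And>B y. B \<in> A \<Longrightarrow> y \<in> ob Y B \<Longrightarrow> \<chi> B (inrE T X Y B y) = \<psi> B y"
    using ex by metis
  have XY: "is_functor T A X" "is_functor T A Y" using X Y by (auto simp: is_talg_def)
  have "\<chi> D (act ?P B D f U) = act Z B D f (\<chi> B U)"
    if B: "B \<in> A" and D: "D \<in> A" and f: "f \<in> alg_hom T B D" and U: "U \<in> ob ?P B" for B D f U
  proof -
    obtain t where t: "t \<in> terms T (?G B)" "U = ?c B t" using U by (auto simp: tensorE_ob)
    let ?m = "map_sum (act X B D f) (act Y B D f)"
    have t': "subst (\<lambda>x. Var (?m x)) t \<in> terms T (?G D)"
      using t(1) XY[THEN is_functorD(1), OF B D f] by (intro subst_terms) (auto intro!: terms.Var)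
    have "\<chi> D (act ?P B D f U) = term_val (opE Z D) (?v D) (subst (\<lambda>x. Var (?m x)) t)"
      using tensorE_act(1)[OF T X Y B D f t(1)] val[OF D \<chi>[OF D] \<chi>l[OF D] \<chi>r[OF D] t'] t(2) by simp
    also have "\<dots> = term_val (opE Z D) (\<lambda>x. act Z B D f (?v B x)) t"
      unfolding term_val_subst using t(1) \<phi> \<psi> B D f
      by (intro term_val_cong) (auto simp: talg_mor_def is_nat_def)
    also have "\<dots> = act Z B D f (term_val (opE Z B) (?v B) t)"
    proof (rule term_val_hom[symmetric, OF _ _ t(1)])
      show "\<forall>\<sigma>\<in>ops T. \<forall>xs\<in>args T \<sigma> (ob Z B). opE Z B \<sigma> xs \<in> ob Z B"
        using alg(3)[OF B] by (simp add: is_alg_def alg_at_def)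
      show "\<forall>\<sigma>\<in>ops T. \<forall>xs\<in>args T \<sigma> (ob Z B).
          act Z B D f (opE Z B \<sigma> xs) = opE Z D \<sigma> (map (act Z B D f) xs)"
        using Z B D f by (simp add: is_talg_def)
      show "\<forall>x\<in>?G B. ?v B x \<in> ob Z B" using \<phi> \<psi> B by (auto simp: talg_mor_def is_nat_def Pi_iff)
    qed
    also have "\<dots> = act Z B D f (\<chi> B U)" using val[OF B \<chi>[OF B] \<chi>l[OF B] \<chi>r[OF B] t(1)] t(2) by simp
    finally show ?thesis .
  qed
  then have mor: "talg_mor T A ?P Z \<chi>"
    using \<chi>[unfolded alg_hom_def PiE_def] by (auto simp: talg_mor_def is_nat_def alg_at_def Pi_iff)
  have "\<chi>' B U = \<chi> B U"
    if \<chi>': "talg_mor T A ?P Z \<chi>'" and l: "\<And>B x. B \<in> A \<Longrightarrow> x \<in> ob X B \<Longrightarrow> \<chi>' B (inlE T X Y B x) = \<phi> B x"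
      and r: "\<And>B y. B \<in> A \<Longrightarrow> y \<in> ob Y B \<Longrightarrow> \<chi>' B (inrE T X Y B y) = \<psi> B y"
      and B: "B \<in> A" and U: "U \<in> ob ?P B" for \<chi>' B U
  proof -
    obtain t where t: "t \<in> terms T (?G B)" "U = ?c B t" using U by (auto simp: tensorE_ob)
    have "inlE T X Y B x \<in> ob ?P B" if "x \<in> ob X B" for x
      using inlE_inrE_mor(1)[OF T X Y] that B by (auto simp: talg_mor_def is_nat_def)
    moreover have "inrE T X Y B y \<in> ob ?P B" if "y \<in> ob Y B" for y
      using inlE_inrE_mor(2)[OF T X Y] that B by (auto simp: talg_mor_def is_nat_def)
    ultimately have "restrict (\<chi>' B) (ob ?P B) (?c B t) = term_val (opE Z B) (?v B) t"
      using l r B by (intro val[OF B talg_mor_at[OF P \<chi>' B] _ _ t(1)]) auto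
    then show ?thesis using U t val[OF B \<chi>[OF B] \<chi>l[OF B] \<chi>r[OF B] t(1)] by simp
  qed
  with mor \<chi>l \<chi>r show ?thesis by (rule that)
qed

text \<open>\<open>Q \<pitchfork> Z\<close> is the exponential, and \<open>X \<pitchfork>\<^sub>R Z\<close> classifies families of \<open>R\<close>-algebra morphisms.\<close>

lemma compose_alg_hom:
  assumes "f \<in> alg_hom T B D"
  shows "compose (car B) f (alg_id B) = f" and "compose (car B) (alg_id D) f = f"
    and "compose (car B) h (compose (car B) g f) = compose (car B) (compose (car D) h g) f"
proof -
  have f: "f \<in> car B \<rightarrow> car D" "f \<in> extensional (car B)"
    using assms by (auto simp: alg_hom_def PiE_def)
  show "compose (car B) f (alg_id B) = f"
    using f by (intro extensionalityI[of _ "car B"]) (auto simp: alg_id_def compose_def)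
  show "compose (car B) (alg_id D) f = f"
    using f by (intro extensionalityI[of _ "car B"]) (auto simp: alg_id_def compose_def)
  show "compose (car B) h (compose (car B) g f) = compose (car B) (compose (car D) h g) f"
    using f(1) by (rule compose_assoc)
qed

lemma expE_ob:
  assumes "\<theta> \<in> ob (expE T A Q Z) B"
  shows "\<theta> \<in> extensional (exp_dom T A Q B)"
    and "D \<in> A \<Longrightarrow> f \<in> alg_hom T B D \<Longrightarrow> q \<in> ob Q D \<Longrightarrow> \<theta> (D, f, q) \<in> ob Z D"
    and "D \<in> A \<Longrightarrow> E \<in> A \<Longrightarrow> f \<in> alg_hom T B D \<Longrightarrow> g \<in> alg_hom T D E \<Longrightarrow> q \<in> ob Q D \<Longrightarrow>
      \<theta> (E, compose (car B) g f, act Q D E g q) = act Z D E g (\<theta> (D, f, q))"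
  using assms by (auto simp: expE_def)

lemma expE_act:
  assumes "D \<in> A" "f \<in> alg_hom T B' D" "q \<in> ob Q D"
  shows "act (expE T A Q Z) B B' g \<theta> (D, f, q) = \<theta> (D, compose (car B) f g, q)"
  using assms by (simp add: expE_def exp_dom_def)

lemma expE_functor:
  assumes A: "\<forall>M\<in>A. is_alg T M" and Q: "is_functor T A Q" and Z: "is_functor T A Z"
  shows "is_functor T A (expE T A Q Z)"
proof -
  let ?X = "expE T A Q Z"
  note comp = alg_hom_compose[OF A[rule_format]]
  have ext: "act ?X B D f \<theta> \<in> extensional (exp_dom T A Q D)" for B D f \<theta>
    by (simp add: expE_def)
  have "act ?X B D f \<theta> \<in> ob ?X D"
    if B: "B \<in> A" and D: "D \<in> A" and f: "f \<in> alg_hom T B D" and \<theta>: "\<theta> \<in> ob ?X B" for B D f \<theta>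
  proof -
    have "act ?X B D f \<theta> (E, h, q) \<in> ob Z E" if "E \<in> A" "h \<in> alg_hom T D E" "q \<in> ob Q E" for E h q
      using expE_ob(2)[OF \<theta> that(1) comp[OF B f that(2)] that(3)] that by (simp add: expE_act)
    moreover have "act ?X B D f \<theta> (E', compose (car D) k h, act Q E E' k q)
        = act Z E E' k (act ?X B D f \<theta> (E, h, q))"
      if E: "E \<in> A" "E' \<in> A" "h \<in> alg_hom T D E" "k \<in> alg_hom T E E'" "q \<in> ob Q E" for E E' h k q
      using expE_ob(3)[OF \<theta> E(1,2) comp[OF B f E(3)] E(4,5)] E is_functorD(1)[OF Q E(1,2,4,5)]
        comp[OF D E(3,4)] compose_alg_hom(3)[OF f, of k h]
      by (simp add: expE_act)
    ultimately show ?thesis using ext[of B D f \<theta>] by (auto simp: expE_def)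
  qed
  moreover have "act ?X B B (alg_id B) \<theta> = \<theta>" if "B \<in> A" "\<theta> \<in> ob ?X B" for B \<theta>
  proof (rule extensionalityI[OF ext expE_ob(1)[OF that(2)]])
    fix p assume "p \<in> exp_dom T A Q B"
    then show "act ?X B B (alg_id B) \<theta> p = \<theta> p"
      by (auto simp: expE_act exp_dom_def compose_alg_hom(1))
  qed
  moreover have "act ?X B E (compose (car B) g f) \<theta> = act ?X D E g (act ?X B D f \<theta>)"
    if "B \<in> A" "D \<in> A" "E \<in> A" "f \<in> alg_hom T B D" "g \<in> alg_hom T D E" "\<theta> \<in> ob ?X B" for B D E f g \<theta>
  proof (rule extensionalityI[OF ext ext])
    fix p assume "p \<in> exp_dom T A Q E"
    then obtain E' h q where p: "p = (E', h, q)" "E' \<in> A" "h \<in> alg_hom T E E'" "q \<in> ob Q E'"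
      by (auto simp: exp_dom_def)
    then show "act ?X B E (compose (car B) g f) \<theta> p = act ?X D E g (act ?X B D f \<theta>) p"
      using that comp[OF that(2,5) p(3)] compose_alg_hom(3)[OF that(4), of h g] by (simp add: expE_act)
  qed
  ultimately show ?thesis by (auto simp: is_functor_def)
qed

lemma evalE_nat:
  assumes A: "\<forall>M\<in>A. is_alg T M" and Q: "is_functor T A Q"
  shows "is_nat T A (prodE Q (expE T A Q Z)) Z evalE"
proof -
  have "evalE D (act Q B D f q, act (expE T A Q Z) B D f \<theta>) = act Z B D f (evalE B (q, \<theta>))"
    if B: "B \<in> A" and D: "D \<in> A" and f: "f \<in> alg_hom T B D" and q: "q \<in> ob Q B"
      and \<theta>: "\<theta> \<in> ob (expE T A Q Z) B" for B D f q \<theta>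
    using expE_ob(3)[OF \<theta> B D alg_id_hom f q] A B D f is_functorD(1)[OF Q B D f q]
    by (simp add: evalE_def expE_act alg_id_hom compose_alg_hom(1,2)[OF f])
  moreover have "evalE B (q, \<theta>) \<in> ob Z B" if "B \<in> A" "q \<in> ob Q B" "\<theta> \<in> ob (expE T A Q Z) B" for B q \<theta>
    using expE_ob(2)[OF that(3,1) alg_id_hom that(2)] A that by (simp add: evalE_def)
  ultimately show ?thesis by (auto simp: is_nat_def prodE_def)
qed

lemma expE_universal:
  assumes A: "\<forall>M\<in>A. is_alg T M" and P: "is_functor T A P" and Q: "is_functor T A Q"
    and \<alpha>: "is_nat T A (prodE P Q) Z \<alpha>"
  shows "is_nat T A P (expE T A Q Z) (transpose T A P Q \<alpha>)"
    and "B \<in> A \<Longrightarrow> p \<in> ob P B \<Longrightarrow> q \<in> ob Q B \<Longrightarrow> evalE B (q, transpose T A P Q \<alpha> B p) = \<alpha> B (p, q)"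
    and "is_nat T A P (expE T A Q Z) \<beta> \<Longrightarrow>
      (\<And>B p q. B \<in> A \<Longrightarrow> p \<in> ob P B \<Longrightarrow> q \<in> ob Q B \<Longrightarrow> evalE B (q, \<beta> B p) = \<alpha> B (p, q)) \<Longrightarrow>
      B \<in> A \<Longrightarrow> p \<in> ob P B \<Longrightarrow> \<beta> B p = transpose T A P Q \<alpha> B p"
proof -
  let ?Z = "expE T A Q Z" and ?t = "transpose T A P Q \<alpha>"
  have \<alpha>Z: "\<alpha> B (p, q) \<in> ob Z B" if "B \<in> A" "p \<in> ob P B" "q \<in> ob Q B" for B p q
    using \<alpha> that by (auto simp: is_nat_def prodE_def Pi_iff)
  have \<alpha>nat: "\<alpha> D (act P B D f p, act Q B D f q) = act Z B D f (\<alpha> B (p, q))"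
    if "B \<in> A" "D \<in> A" "f \<in> alg_hom T B D" "p \<in> ob P B" "q \<in> ob Q B" for B D f p q
    using \<alpha> that by (auto simp: is_nat_def prodE_def)
  note comp = alg_hom_compose[OF A[rule_format]]
  have t: "?t B p (D, f, q) = \<alpha> D (act P B D f p, q)"
    if "D \<in> A" "f \<in> alg_hom T B D" "q \<in> ob Q D" for B p D f q
    using that by (simp add: transpose_def exp_dom_def)
  have t_ext: "?t B p \<in> extensional (exp_dom T A Q B)" for B p by (simp add: transpose_def)
  have "?t B p \<in> ob ?Z B" if B: "B \<in> A" and p: "p \<in> ob P B" for B p
  proof -
    have "?t B p (E, compose (car B) g f, act Q D E g q) = act Z D E g (?t B p (D, f, q))"
      if D: "D \<in> A" "E \<in> A" "f \<in> alg_hom T B D" "g \<in> alg_hom T D E" "q \<in> ob Q D" for D E f g q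
      using D is_functorD(1)[OF Q D(1,2,4,5)] comp[OF B D(3,4)] is_functorD(3)[OF P B D(1-4) p]
        \<alpha>nat[OF D(1,2,4) is_functorD(1)[OF P B D(1,3) p] D(5)]
      by (simp add: t)
    moreover have "?t B p (D, f, q) \<in> ob Z D" if "D \<in> A" "f \<in> alg_hom T B D" "q \<in> ob Q D" for D f q
      using that \<alpha>Z is_functorD(1)[OF P B that(1,2) p] by (simp add: t)
    ultimately show ?thesis using t_ext[of B p] by (simp add: expE_def)
  qed
  moreover have "?t D (act P B D f p) = act ?Z B D f (?t B p)"
    if B: "B \<in> A" and D: "D \<in> A" and f: "f \<in> alg_hom T B D" and p: "p \<in> ob P B" for B D f p
  proof (rule extensionalityI[OF t_ext])
    show "act ?Z B D f (?t B p) \<in> extensional (exp_dom T A Q D)" by (simp add: expE_def)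
    fix x assume "x \<in> exp_dom T A Q D"
    then obtain E g q where x: "x = (E, g, q)" "E \<in> A" "g \<in> alg_hom T D E" "q \<in> ob Q E"
      by (auto simp: exp_dom_def)
    then show "?t D (act P B D f p) x = act ?Z B D f (?t B p) x"
      using is_functorD(3)[OF P B D x(2) f x(3) p] comp[OF B f x(3)] by (simp add: t expE_act)
  qed
  ultimately show "is_nat T A P ?Z ?t" by (auto simp: is_nat_def)
  show "evalE B (q, ?t B p) = \<alpha> B (p, q)" if "B \<in> A" "p \<in> ob P B" "q \<in> ob Q B"
    using that A is_functorD(2)[OF P that(1,2)] by (simp add: evalE_def t alg_id_hom)
  show "\<beta> B p = ?t B p"
    if \<beta>: "is_nat T A P ?Z \<beta>" and ev: "\<And>B p q. B \<in> A \<Longrightarrow> p \<in> ob P B \<Longrightarrow> q \<in> ob Q B \<Longrightarrow> evalE B (q, \<beta> B p) = \<alpha> B (p, q)"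
      and B: "B \<in> A" and p: "p \<in> ob P B"
  proof (rule extensionalityI[OF _ t_ext])
    have "\<beta> B p \<in> ob ?Z B" using \<beta> B p by (auto simp: is_nat_def)
    then show "\<beta> B p \<in> extensional (exp_dom T A Q B)" by (rule expE_ob(1))
    fix x assume "x \<in> exp_dom T A Q B"
    then obtain D f q where x: "x = (D, f, q)" "D \<in> A" "f \<in> alg_hom T B D" "q \<in> ob Q D"
      by (auto simp: exp_dom_def)
    have "\<beta> D (act P B D f p) = act ?Z B D f (\<beta> B p)" using \<beta> B p x by (simp add: is_nat_def)
    then have "\<beta> D (act P B D f p) (D, alg_id D, q) = \<beta> B p (D, f, q)"
      using A x by (simp add: expE_act alg_id_hom compose_alg_hom(2)[OF x(3)])
    then show "\<beta> B p x = ?t B p x"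
      using ev[OF x(2) is_functorD(1)[OF P B x(2,3) p] x(4)] x by (simp add: evalE_def t)
  qed
qed

lemma homR_factor:
  assumes A: "\<forall>M\<in>A. is_alg T M" and P: "is_functor T A P"
    and X: "is_ralg T A X"
    and \<beta>: "is_nat T A P (expE T A X Z) \<beta>"
  shows "is_nat T A P (homR T A X Z) \<beta> \<longleftrightarrow>
    (\<forall>B\<in>A. \<forall>p\<in>ob P B.
      (\<forall>\<sigma>\<in>ops T. \<forall>xs\<in>args T \<sigma> (ob X B).
        evalE B (opE X B \<sigma> xs, \<beta> B p) = opE Z B \<sigma> (map (\<lambda>x. evalE B (x, \<beta> B p)) xs)) \<and>
      (\<forall>r\<in>car B. evalE B (str X B r, \<beta> B p) = str Z B r))" (is "?L \<longleftrightarrow> ?R")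
proof
  assume ?L
  then have "\<beta> B p \<in> ob (homR T A X Z) B" if "B \<in> A" "p \<in> ob P B" for B p
    using that by (auto simp: is_nat_def)
  then show ?R using A by (simp add: homR_def evalE_def alg_id_hom)
next
  assume R: ?R
  have ev: "evalE D (x, \<beta> D (act P B D f p)) = \<beta> B p (D, f, x)"
    if "B \<in> A" "D \<in> A" "f \<in> alg_hom T B D" "p \<in> ob P B" "x \<in> ob X D" for B D f p x
    using \<beta> that A compose_alg_hom(2)[OF that(3)]
    by (simp add: is_nat_def evalE_def expE_act alg_id_hom)
  have opX: "opE X D \<sigma> xs \<in> ob X D" if "D \<in> A" "\<sigma> \<in> ops T" "xs \<in> args T \<sigma> (ob X D)" for D \<sigma> xs
    using X that by (auto simp: is_ralg_def is_talg_def is_alg_def alg_at_def)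
  have strX: "str X D r \<in> ob X D" if "D \<in> A" "r \<in> car D" for D r
    using X that by (auto simp: is_ralg_def talg_mor_def is_nat_def R_obj_def)
  have "\<beta> B p \<in> ob (homR T A X Z) B" if B: "B \<in> A" and p: "p \<in> ob P B" for B p
  proof -
    have "\<beta> B p (D, f, opE X D \<sigma> xs) = opE Z D \<sigma> (map (\<lambda>x. \<beta> B p (D, f, x)) xs)"
      if D: "D \<in> A" "f \<in> alg_hom T B D" "\<sigma> \<in> ops T" "xs \<in> args T \<sigma> (ob X D)" for D f \<sigma> xs
    proof -
      have "map (\<lambda>x. \<beta> B p (D, f, x)) xs = map (\<lambda>x. evalE D (x, \<beta> D (act P B D f p))) xs"
        using D ev[OF B D(1,2) p] by (intro map_cong) (auto simp: args_def)
      then show ?thesis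
        using R D is_functorD(1)[OF P B D(1,2) p] ev[OF B D(1,2) p opX[OF D(1,3,4)]] by metis
    qed
    moreover have "\<beta> B p (D, f, str X D r) = str Z D r"
      if D: "D \<in> A" "f \<in> alg_hom T B D" "r \<in> car D" for D f r
      using R D is_functorD(1)[OF P B D(1,2) p] ev[OF B D(1,2) p strX[OF D(1,3)]] by metis
    moreover have "\<beta> B p \<in> ob (expE T A X Z) B" using \<beta> B p by (auto simp: is_nat_def)
    ultimately show ?thesis by (simp add: homR_def)
  qed
  then show ?L using \<beta> by (simp add: is_nat_def homR_def)
qed

end

(* The idea: at a stage B, the object S of R-algebra morphisms R (x) gamma*(C) -> R is Hom(C, B), since
   such a morphism is the identity on R and is therefore determined by a homomorphism C -> B. So S is
   represented by C, and an element of (S => R)(B) is a natural transformation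
   Hom(B, -) x Hom(C, -) -> R.  As A contains a coproduct P of B and C, this is by Yoneda an element of P,
   and under this identification the Dirac map is the isomorphism of B (x) C with P. *)

theory Submission
  imports Defs
begin

section \<open>Homomorphisms out of a coproduct\<close>

text \<open>Yoneda needs a representing object inside \<open>A\<close>, but
  \<open>alg_coprod T B C\<close> has a carrier of another type and \<open>A\<close> need not be
  replete. So the universal pair of injections is transported to an isomorphic P in
  \<open>A\<close>. The Dirac map sends u to the family (f, g) \<mapsto> [f, g](u), and every such
  pair is the image of the universal one under a map out of P. The representation of S enters only
  through \<open>yon\<close>, namely its surjectivity, its naturality and this formula, so no
  natural isomorphism between S and Hom(C, -) is built. Nor is an inverse of the Dirac map written
  down: bijectivity at each stage is enough, which lets P be chosen separately for each B.\<close>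

text \<open>Unlike \<open>alg_hom\<close>, this says nothing about the values outside the carrier.\<close>

definition alg_map :: "'f alg_theory \<Rightarrow> ('f, 'a) alg \<Rightarrow> ('f, 'b) alg \<Rightarrow> ('a \<Rightarrow> 'b) \<Rightarrow> bool" where
  "alg_map T M N \<phi> \<longleftrightarrow> \<phi> \<in> car M \<rightarrow> car N \<and>
     (\<forall>\<sigma>\<in>ops T. \<forall>xs\<in>args T \<sigma> (car M). \<phi> (opn M \<sigma> xs) = opn N \<sigma> (map \<phi> xs))"

lemma alg_mapD:
  assumes "alg_map T M N \<phi>"
  shows "x \<in> car M \<Longrightarrow> \<phi> x \<in> car N"
    and "\<sigma> \<in> ops T \<Longrightarrow> xs \<in> args T \<sigma> (car M) \<Longrightarrow> \<phi> (opn M \<sigma> xs) = opn N \<sigma> (map \<phi> xs)"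
  using assms by (auto simp: alg_map_def)

lemma alg_hom_iff: "h \<in> alg_hom T M N \<longleftrightarrow> alg_map T M N h \<and> h \<in> extensional (car M)"
  by (auto simp: alg_hom_def alg_map_def PiE_def)

lemma alg_hom_map: "h \<in> alg_hom T M N \<Longrightarrow> alg_map T M N h"
  by (simp add: alg_hom_iff)

text \<open>The carrier of an algebra is closed under the operations, so both sides of the
  homomorphism law are evaluated inside it.\<close>

lemma alg_map_cong:
  assumes "is_alg T M" "\<And>x. x \<in> car M \<Longrightarrow> \<phi> x = \<psi> x"
  shows "alg_map T M N \<phi> \<longleftrightarrow> alg_map T M N \<psi>"
proof -
  have "\<phi> (opn M \<sigma> xs) = \<psi> (opn M \<sigma> xs)" "map \<phi> xs = map \<psi> xs"
    if "\<sigma> \<in> ops T" "xs \<in> args T \<sigma> (car M)" for \<sigma> xs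
  proof -
    have "opn M \<sigma> xs \<in> car M" using assms(1) that by (simp add: is_alg_def)
    then show "\<phi> (opn M \<sigma> xs) = \<psi> (opn M \<sigma> xs)" by (rule assms(2))
    show "map \<phi> xs = map \<psi> xs" using that(2) assms(2) by (auto simp: args_def)
  qed
  moreover have "\<phi> \<in> car M \<rightarrow> car N \<longleftrightarrow> \<psi> \<in> car M \<rightarrow> car N" using assms(2) by (auto simp: Pi_iff)
  ultimately show ?thesis unfolding alg_map_def by (metis (full_types))
qed

lemma alg_map_restrict:
  assumes "is_alg T M" "alg_map T M N \<phi>"
  shows "restrict \<phi> (car M) \<in> alg_hom T M N"
  using assms alg_map_cong[OF assms(1), of "restrict \<phi> (car M)" \<phi> N] by (simp add: alg_hom_iff)

lemma alg_map_comp: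
  assumes "alg_map T M N \<phi>" "alg_map T N K \<psi>"
  shows "alg_map T M K (\<lambda>x. \<psi> (\<phi> x))"
proof -
  have "\<psi> (\<phi> (opn M \<sigma> xs)) = opn K \<sigma> (map (\<lambda>x. \<psi> (\<phi> x)) xs)"
    if "\<sigma> \<in> ops T" "xs \<in> args T \<sigma> (car M)" for \<sigma> xs
  proof -
    have "map \<phi> xs \<in> args T \<sigma> (car N)"
      using that(2) alg_mapD(1)[OF assms(1)] by (auto simp: args_def)
    then show ?thesis
      using alg_mapD(2)[OF assms(1) that] alg_mapD(2)[OF assms(2) that(1)] by (simp add: comp_def)
  qed
  then show ?thesis using assms by (auto simp: alg_map_def)
qed

lemma alg_map_ident: "alg_map T M M (\<lambda>x. x)"
  by (simp add: alg_map_def)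

lemma alg_inl_inr_map:
  assumes "is_alg T M" "is_alg T N"
  shows "alg_map T M (alg_coprod T M N) (alg_inl T M N)"
    and "alg_map T N (alg_coprod T M N) (alg_inr T M N)"
  using alg_inl_hom[OF assms(1)] alg_inr_hom[OF assms(2)] by (auto simp: alg_hom_iff)

text \<open>This is the uniqueness half of \<open>coprod_universal\<close>, applied to restrictions.
  It is phrased for \<open>alg_map\<close> because \<open>act\<close> and \<open>copair\<close> are
  not extensional. Most identities between maps out of a coproduct below are proved by it.\<close>

lemma coprod_map_unique:
  assumes T: "wf_theory T" and M: "is_alg T M" and N: "is_alg T N" and K: "is_alg T K"
    and \<phi>: "alg_map T (alg_coprod T M N) K \<phi>" and \<psi>: "alg_map T (alg_coprod T M N) K \<psi>"
    and l: "\<And>x. x \<in> car M \<Longrightarrow> \<phi> (alg_inl T M N x) = \<psi> (alg_inl T M N x)"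
    and r: "\<And>y. y \<in> car N \<Longrightarrow> \<phi> (alg_inr T M N y) = \<psi> (alg_inr T M N y)"
    and u: "u \<in> car (alg_coprod T M N)"
  shows "\<phi> u = \<psi> u"
proof -
  let ?P = "alg_coprod T M N"
  note inj = alg_inl_inr_map[OF M N]
  note P = is_alg_coprod[OF T, of M N]
  let ?h = "restrict (\<lambda>x. \<phi> (alg_inl T M N x)) (car M)"
  let ?k = "restrict (\<lambda>y. \<phi> (alg_inr T M N y)) (car N)"
  have "?h \<in> alg_hom T M K" "?k \<in> alg_hom T N K"
    using alg_map_restrict[OF M alg_map_comp[OF inj(1) \<phi>]]
      alg_map_restrict[OF N alg_map_comp[OF inj(2) \<phi>]] by auto
  from coprod_universal[OF T M N K this]
  have "\<exists>\<^sub>\<le>\<^sub>1v. v \<in> alg_hom T ?P K \<and>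
      (\<forall>x\<in>car M. v (alg_inl T M N x) = ?h x) \<and> (\<forall>y\<in>car N. v (alg_inr T M N y) = ?k y)"
    unfolding Uniq_def by blast
  then have "restrict \<phi> (car ?P) = restrict \<psi> (car ?P)"
    using alg_map_restrict[OF P \<phi>] alg_map_restrict[OF P \<psi>] inj[THEN alg_mapD(1)] l r
    by (elim Uniq_D) simp_all
  then show ?thesis using u by (metis restrict_apply')
qed

text \<open>The copairing [h, k]. It is chosen with \<open>SOME\<close> because the map is
  determined only on the carrier of the coproduct.\<close>

definition copair :: "'f alg_theory \<Rightarrow> ('f, 'a) alg \<Rightarrow> ('f, 'b) alg \<Rightarrow> ('f, 'c) alg
    \<Rightarrow> ('a \<Rightarrow> 'c) \<Rightarrow> ('b \<Rightarrow> 'c) \<Rightarrow> ('f, 'a + 'b) trm set \<Rightarrow> 'c" where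
  "copair T M N K h k = (SOME u. alg_map T (alg_coprod T M N) K u \<and>
     (\<forall>x\<in>car M. u (alg_inl T M N x) = h x) \<and> (\<forall>y\<in>car N. u (alg_inr T M N y) = k y))"

text \<open>Both sides choose from the same predicate, hence the functions are equal everywhere and
  not only on the carrier.\<close>

lemma copair_cong:
  assumes "\<And>x. x \<in> car M \<Longrightarrow> h x = h' x" "\<And>y. y \<in> car N \<Longrightarrow> k y = k' y"
  shows "copair T M N K h k = copair T M N K h' k'"
  unfolding copair_def using assms by simp

lemma copair:
  assumes T: "wf_theory T" and M: "is_alg T M" and N: "is_alg T N" and K: "is_alg T K"
    and h: "alg_map T M K h" and k: "alg_map T N K k"
  shows "alg_map T (alg_coprod T M N) K (copair T M N K h k)"
    and "x \<in> car M \<Longrightarrow> copair T M N K h k (alg_inl T M N x) = h x"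
    and "y \<in> car N \<Longrightarrow> copair T M N K h k (alg_inr T M N y) = k y"
proof -
  have "\<exists>u. alg_map T (alg_coprod T M N) K u \<and>
     (\<forall>x\<in>car M. u (alg_inl T M N x) = h x) \<and> (\<forall>y\<in>car N. u (alg_inr T M N y) = k y)"
    using coprod_universal[OF T M N K alg_map_restrict[OF M h] alg_map_restrict[OF N k]]
    by (auto simp: alg_hom_iff)
  from someI_ex[OF this, folded copair_def]
  show "alg_map T (alg_coprod T M N) K (copair T M N K h k)"
    and "x \<in> car M \<Longrightarrow> copair T M N K h k (alg_inl T M N x) = h x"
    and "y \<in> car N \<Longrightarrow> copair T M N K h k (alg_inr T M N y) = k y"
    by auto
qed

section \<open>\<open>R\<close>-algebras and the Dirac map\<close>

text \<open>The stagewise inverse is automatically natural, homomorphic and compatible with the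
  structure maps: each law follows by applying \<alpha> to it and cancelling, which is what
  \<open>eqI\<close> packages.\<close>

lemma ralg_mor_bij_iso:
  assumes \<alpha>: "ralg_mor T A X Y \<alpha>" and bij: "\<And>B. B \<in> A \<Longrightarrow> bij_betw (\<alpha> B) (ob X B) (ob Y B)"
  shows "ralg_iso T A X Y \<alpha>"
proof -
  define \<beta> where "\<beta> B = inv_into (ob X B) (\<alpha> B)" for B
  have X: "is_ralg T A X" and Y: "is_ralg T A Y" and mor: "talg_mor T A X Y \<alpha>"
    and str: "\<forall>B\<in>A. \<forall>r\<in>car B. \<alpha> B (str X B r) = str Y B r"
    using \<alpha> by (auto simp: ralg_mor_def)
  have \<beta>\<alpha>: "\<beta> B (\<alpha> B x) = x" if "B \<in> A" "x \<in> ob X B" for B x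
    using bij[OF that(1)] that(2) by (simp add: \<beta>_def bij_betw_inv_into_left)
  have \<alpha>\<beta>: "\<alpha> B (\<beta> B y) = y" and \<beta>X: "\<beta> B y \<in> ob X B" if "B \<in> A" "y \<in> ob Y B" for B y
    using bij[OF that(1)] that(2)
    by (auto simp: \<beta>_def bij_betw_inv_into_right bij_betw_def intro: inv_into_into)
  have eqI: "\<beta> B y = x" if "B \<in> A" "x \<in> ob X B" "\<alpha> B x = y" for B x y
    using \<beta>\<alpha>[OF that(1,2)] that(3) by simp
  have Xact: "act X B D f x \<in> ob X D" if "B \<in> A" "D \<in> A" "f \<in> alg_hom T B D" "x \<in> ob X B" for B D f x
    using X that by (auto simp: is_ralg_def is_talg_def dest: is_functorD(1))
  have Xop: "opE X B \<sigma> xs \<in> ob X B" if "B \<in> A" "\<sigma> \<in> ops T" "xs \<in> args T \<sigma> (ob X B)" for B \<sigma> xs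
    using X that by (auto simp: is_ralg_def is_talg_def is_alg_def alg_at_def)
  have Xstr: "str X B r \<in> ob X B" if "B \<in> A" "r \<in> car B" for B r
    using X that by (auto simp: is_ralg_def talg_mor_def is_nat_def R_obj_def)
  have "\<beta> D (act Y B D f y) = act X B D f (\<beta> B y)"
    if "B \<in> A" "D \<in> A" "f \<in> alg_hom T B D" "y \<in> ob Y B" for B D f y
  proof (rule eqI[OF that(2) Xact[OF that(1-3) \<beta>X[OF that(1,4)]]])
    show "\<alpha> D (act X B D f (\<beta> B y)) = act Y B D f y"
      using mor that \<beta>X[OF that(1,4)] \<alpha>\<beta>[OF that(1,4)] by (simp add: talg_mor_def is_nat_def)
  qed
  moreover have "\<beta> B (opE Y B \<sigma> ys) = opE X B \<sigma> (map (\<beta> B) ys)"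
    if "B \<in> A" "\<sigma> \<in> ops T" "ys \<in> args T \<sigma> (ob Y B)" for B \<sigma> ys
  proof -
    have xs: "map (\<beta> B) ys \<in> args T \<sigma> (ob X B)" using that \<beta>X by (auto simp: args_def)
    have "map (\<alpha> B) (map (\<beta> B) ys) = ys"
      using that \<alpha>\<beta> by (auto simp: args_def intro!: map_idI)
    then have "\<alpha> B (opE X B \<sigma> (map (\<beta> B) ys)) = opE Y B \<sigma> ys"
      using mor that xs by (simp add: talg_mor_def del: map_map)
    then show ?thesis by (rule eqI[OF that(1) Xop[OF that(1,2) xs]])
  qed
  ultimately have "talg_mor T A Y X \<beta>" using \<beta>X by (auto simp: talg_mor_def is_nat_def)
  moreover have "\<forall>B\<in>A. \<forall>r\<in>car B. \<beta> B (str Y B r) = str X B r"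
    using eqI Xstr str by blast
  ultimately have "ralg_mor T A Y X \<beta>" using X Y by (simp add: ralg_mor_def)
  then show ?thesis using \<alpha> \<beta>\<alpha> \<alpha>\<beta> by (auto simp: ralg_iso_def)
qed

section \<open>The algebra objects R, the constant algebra of C, and R \<otimes> Y\<close>

lemma alg_at_R_obj: "alg_at R_obj B = B"
  by (simp add: alg_at_def R_obj_def)

lemma is_talg_R_obj:
  assumes "\<forall>M\<in>A. is_alg T M"
  shows "is_talg T A R_obj"
  using assms unfolding is_talg_def alg_at_R_obj
  by (auto simp: is_functor_def R_obj_def alg_hom_def alg_id_def compose_def PiE_def Pi_iff)

lemma is_ralg_R_ralg:
  assumes "\<forall>M\<in>A. is_alg T M"
  shows "is_ralg T A R_ralg"
  using is_talg_R_obj[OF assms]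
  by (simp add: is_ralg_def is_talg_def is_functor_def talg_mor_def is_nat_def alg_at_def R_ralg_def
      R_obj_def talg.defs ralg.defs)

lemma alg_at_gamma_obj: "alg_at (gamma_obj C) B = C"
  by (simp add: alg_at_def gamma_obj_def)

lemma gamma_obj_sel: "ob (gamma_obj C) B = car C" "act (gamma_obj C) B D f x = x"
  by (simp_all add: gamma_obj_def)

lemma is_talg_gamma_obj:
  assumes "is_alg T C"
  shows "is_talg T A (gamma_obj C)"
  using assms unfolding is_talg_def alg_at_gamma_obj
  by (auto simp: is_functor_def gamma_obj_def)

lemma R_tensor_sel:
  "ob (R_tensor T Y) = ob (tensorE T R_obj Y)" "act (R_tensor T Y) = act (tensorE T R_obj Y)"
  "opE (R_tensor T Y) = opE (tensorE T R_obj Y)" "str (R_tensor T Y) = inlE T R_obj Y"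
  by (simp_all add: R_tensor_def talg.defs ralg.defs)

lemma is_ralg_R_tensor:
  assumes T: "wf_theory T" and A: "\<forall>M\<in>A. is_alg T M" and Y: "is_talg T A Y"
  shows "is_ralg T A (R_tensor T Y)"
  using is_talg_tensorE[OF T A is_talg_R_obj[OF A] Y] inlE_inrE_mor(1)[OF T is_talg_R_obj[OF A] Y]
  by (simp add: is_ralg_def is_talg_def is_functor_def talg_mor_def is_nat_def alg_at_def R_tensor_sel)

lemma is_ralgD:
  assumes "is_ralg T A X"
  shows "is_functor T A X"
    and "B \<in> A \<Longrightarrow> is_alg T (alg_at X B)"
    and "B \<in> A \<Longrightarrow> \<sigma> \<in> ops T \<Longrightarrow> xs \<in> args T \<sigma> (ob X B) \<Longrightarrow> opE X B \<sigma> xs \<in> ob X B"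
    and "B \<in> A \<Longrightarrow> D \<in> A \<Longrightarrow> f \<in> alg_hom T B D \<Longrightarrow> \<sigma> \<in> ops T \<Longrightarrow> xs \<in> args T \<sigma> (ob X B)
      \<Longrightarrow> act X B D f (opE X B \<sigma> xs) = opE X D \<sigma> (map (act X B D f) xs)"
    and "B \<in> A \<Longrightarrow> r \<in> car B \<Longrightarrow> str X B r \<in> ob X B"
    and "B \<in> A \<Longrightarrow> D \<in> A \<Longrightarrow> f \<in> alg_hom T B D \<Longrightarrow> r \<in> car B
      \<Longrightarrow> act X B D f (str X B r) = str X D (f r)"
  using assms by (auto simp: is_ralg_def is_talg_def is_alg_def alg_at_def talg_mor_def is_nat_def R_obj_def Pi_iff)

section \<open>The functor of R-algebra morphisms\<close>

lemma homR_ob: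
  assumes "\<theta> \<in> ob (homR T A X Z) B"
  shows "\<theta> \<in> ob (expE T A X Z) B"
    and "D \<in> A \<Longrightarrow> f \<in> alg_hom T B D \<Longrightarrow> \<sigma> \<in> ops T \<Longrightarrow> xs \<in> args T \<sigma> (ob X D)
      \<Longrightarrow> \<theta> (D, f, opE X D \<sigma> xs) = opE Z D \<sigma> (map (\<lambda>x. \<theta> (D, f, x)) xs)"
    and "D \<in> A \<Longrightarrow> f \<in> alg_hom T B D \<Longrightarrow> r \<in> car D \<Longrightarrow> \<theta> (D, f, str X D r) = str Z D r"
  using assms by (auto simp: homR_def)

lemma homR_act: "act (homR T A X Z) = act (expE T A X Z)"
  by (simp add: homR_def)

text \<open>The defining condition at stage B ranges over all arrows out of B, so the condition on
  the translate of \<theta> along f, taken at g, is the condition on \<theta> at the composite of g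
  and f.\<close>

lemma homR_functor:
  assumes A: "\<forall>M\<in>A. is_alg T M" and X: "is_ralg T A X" and Z: "is_functor T A Z"
  shows "is_functor T A (homR T A X Z)"
proof -
  note E = expE_functor[OF A is_ralgD(1)[OF X] Z]
  have "act (expE T A X Z) B D f \<theta> \<in> ob (homR T A X Z) D"
    if B: "B \<in> A" and D: "D \<in> A" and f: "f \<in> alg_hom T B D" and \<theta>: "\<theta> \<in> ob (homR T A X Z) B" for B D f \<theta>
  proof -
    let ?\<theta> = "act (expE T A X Z) B D f \<theta>"
    have "?\<theta> (E, g, opE X E \<sigma> xs) = opE Z E \<sigma> (map (\<lambda>x. ?\<theta> (E, g, x)) xs)"
      if E: "E \<in> A" "g \<in> alg_hom T D E" and \<sigma>: "\<sigma> \<in> ops T" "xs \<in> args T \<sigma> (ob X E)" for E g \<sigma> xs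
    proof -
      have "map (\<lambda>x. ?\<theta> (E, g, x)) xs = map (\<lambda>x. \<theta> (E, compose (car B) g f, x)) xs"
        using \<sigma> E by (intro map_cong) (auto simp: args_def expE_act subset_iff)
      then show ?thesis
        using homR_ob(2)[OF \<theta> E(1) _ \<sigma>] alg_hom_compose[OF _ f E(2)] A B is_ralgD(3)[OF X E(1) \<sigma>] E
        by (simp add: expE_act cong: map_cong)
    qed
    moreover have "?\<theta> (E, g, str X E r) = str Z E r"
      if E: "E \<in> A" "g \<in> alg_hom T D E" and r: "r \<in> car E" for E g r
      using homR_ob(3)[OF \<theta> E(1) _ r] alg_hom_compose[OF _ f E(2)] A B is_ralgD(5)[OF X E(1) r] E
      by (simp add: expE_act)
    ultimately show ?thesis
      using is_functorD(1)[OF E B D f homR_ob(1)[OF \<theta>]] by (simp add: homR_def)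
  qed
  then show ?thesis
    using E homR_ob(1)[of _ T A X Z] by (auto simp: is_functor_def homR_act)
qed

section \<open>The R-algebra of maps from S to R\<close>

lemma exp_ralg_sel:
  "ob (exp_ralg T A S) = ob (expE T A S R_obj)" "act (exp_ralg T A S) = act (expE T A S R_obj)"
  "str (exp_ralg T A S) = transpose T A R_obj S (\<lambda>B. fst)"
  by (simp_all add: exp_ralg_def)

lemma exp_ralg_op:
  "opE (exp_ralg T A S) B \<sigma> \<theta>s \<in> extensional (exp_dom T A S B)"
  "D \<in> A \<Longrightarrow> f \<in> alg_hom T B D \<Longrightarrow> s \<in> ob S D \<Longrightarrow>
    opE (exp_ralg T A S) B \<sigma> \<theta>s (D, f, s) = opn D \<sigma> (map (\<lambda>\<theta>. \<theta> (D, f, s)) \<theta>s)"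
  by (simp_all add: exp_ralg_def exp_dom_def)

text \<open>Evaluation at a point (D, f, s) commutes with the operations. Hence the equations of the
  theory hold in \<open>exp_ralg\<close> because they hold in each D.\<close>

lemma exp_ralg_term_val:
  assumes "D \<in> A" "f \<in> alg_hom T B D" "s \<in> ob S D"
  shows "term_val (opE (exp_ralg T A S) B) v t (D, f, s) = term_val (opn D) (\<lambda>n. v n (D, f, s)) t"
  using assms by (induction t) (simp_all add: exp_ralg_op comp_def cong: map_cong)

lemma is_ralg_exp_ralg:
  assumes A: "\<forall>M\<in>A. is_alg T M" and S: "is_functor T A S"
  shows "is_ralg T A (exp_ralg T A S)"
proof -
  let ?Y = "exp_ralg T A S"
  note R = is_talg_R_obj[OF A]
  have RF: "is_functor T A R_obj" using R by (simp add: is_talg_def)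
  note comp = alg_hom_compose[OF A[rule_format]]
  have YF: "is_functor T A ?Y"
    using expE_functor[OF A S RF] by (simp add: is_functor_def exp_ralg_sel)
  have at: "map (\<lambda>\<theta>. \<theta> (D, f, s)) \<theta>s \<in> args T \<sigma> (car D)"
    if "\<theta>s \<in> args T \<sigma> (ob ?Y B)" "D \<in> A" "f \<in> alg_hom T B D" "s \<in> ob S D" for B D f s \<sigma> \<theta>s
    using that expE_ob(2)[of _ T A S R_obj B D f s]
    by (auto simp: args_def exp_ralg_sel R_obj_def subset_iff)
  have op: "opE ?Y B \<sigma> \<theta>s \<in> ob ?Y B"
    if B: "B \<in> A" and \<sigma>: "\<sigma> \<in> ops T" and \<theta>s: "\<theta>s \<in> args T \<sigma> (ob ?Y B)" for B \<sigma> \<theta>s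
  proof -
    have "opE ?Y B \<sigma> \<theta>s (D, f, s) \<in> car D" if "D \<in> A" "f \<in> alg_hom T B D" "s \<in> ob S D" for D f s
      using at[OF \<theta>s that] A that \<sigma> by (simp add: exp_ralg_op is_alg_def)
    moreover have "opE ?Y B \<sigma> \<theta>s (E, compose (car B) g f, act S D E g s) = g (opE ?Y B \<sigma> \<theta>s (D, f, s))"
      if D: "D \<in> A" "E \<in> A" "f \<in> alg_hom T B D" "g \<in> alg_hom T D E" "s \<in> ob S D" for D E f g s
    proof -
      \<comment> \<open>A pointwise operation yields a natural family again because the arrow g is
        itself a homomorphism.\<close>
      have "map (\<lambda>\<theta>. \<theta> (E, compose (car B) g f, act S D E g s)) \<theta>s = map g (map (\<lambda>\<theta>. \<theta> (D, f, s)) \<theta>s)"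
        using \<theta>s expE_ob(3)[OF _ D, of _ R_obj] by (auto simp: args_def exp_ralg_sel R_obj_def)
      moreover have "g (opn D \<sigma> (map (\<lambda>\<theta>. \<theta> (D, f, s)) \<theta>s)) = opn E \<sigma> (map g (map (\<lambda>\<theta>. \<theta> (D, f, s)) \<theta>s))"
        using D(4) \<sigma> at[OF \<theta>s D(1,3,5)] by (simp add: alg_hom_def del: map_map)
      ultimately show ?thesis
        using D comp[OF B D(3,4)] is_functorD(1)[OF S D(1,2,4,5)] by (simp add: exp_ralg_op del: map_map)
    qed
    ultimately show ?thesis
      using exp_ralg_op(1)[of T A S B \<sigma> \<theta>s] unfolding exp_ralg_sel by (simp add: expE_def R_obj_def)
  qed
  have alg: "is_alg T (alg_at ?Y B)" if B: "B \<in> A" for B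
  proof -
    have "term_val (opE ?Y B) v s = term_val (opE ?Y B) v t"
      if st: "(s, t) \<in> eqs T" and v: "range v \<subseteq> ob ?Y B" for s t v
    proof (rule extensionalityI)
      \<comment> \<open>A term value is either some \<open>v n\<close> or the result of an
        operation, and both are extensional.\<close>
      have "v n \<in> extensional (exp_dom T A S B)" for n
        using v expE_ob(1)[of "v n" T A S R_obj B] by (auto simp: exp_ralg_sel)
      then show "term_val (opE ?Y B) v s \<in> extensional (exp_dom T A S B)"
        and "term_val (opE ?Y B) v t \<in> extensional (exp_dom T A S B)"
        using exp_ralg_op(1)[of T A S B] by (cases s; cases t; simp)+
      fix p assume "p \<in> exp_dom T A S B"
      then obtain D f q where p: "p = (D, f, q)" "D \<in> A" "f \<in> alg_hom T B D" "q \<in> ob S D"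
        by (auto simp: exp_dom_def)
      have "range (\<lambda>n. v n (D, f, q)) \<subseteq> car D"
        using v expE_ob(2)[OF _ p(2-4), of _ R_obj] by (auto simp: exp_ralg_sel R_obj_def)
      then have "term_val (opn D) (\<lambda>n. v n (D, f, q)) s = term_val (opn D) (\<lambda>n. v n (D, f, q)) t"
        using A p(2) st unfolding is_alg_def by fast
      then show "term_val (opE ?Y B) v s p = term_val (opE ?Y B) v t p"
        using exp_ralg_term_val[OF p(2-4)] p(1) by metis
    qed
    then show ?thesis using op[OF B] by (auto simp: is_alg_def alg_at_def)
  qed
  have "act ?Y B D f (opE ?Y B \<sigma> \<theta>s) = opE ?Y D \<sigma> (map (act ?Y B D f) \<theta>s)"
    if B: "B \<in> A" and D: "D \<in> A" and f: "f \<in> alg_hom T B D" for B D f \<sigma> \<theta>s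
  proof (rule extensionalityI[OF _ exp_ralg_op(1)])
    show "act ?Y B D f (opE ?Y B \<sigma> \<theta>s) \<in> extensional (exp_dom T A S D)"
      by (simp add: exp_ralg_sel expE_def)
    fix p assume "p \<in> exp_dom T A S D"
    then obtain E g q where p: "p = (E, g, q)" "E \<in> A" "g \<in> alg_hom T D E" "q \<in> ob S E"
      by (auto simp: exp_dom_def)
    then show "act ?Y B D f (opE ?Y B \<sigma> \<theta>s) p = opE ?Y D \<sigma> (map (act ?Y B D f) \<theta>s) p"
      using comp[OF B f p(3)] by (simp add: exp_ralg_op exp_ralg_sel expE_act comp_def)
  qed
  then have talg: "is_talg T A ?Y" using YF alg by (auto simp: is_talg_def)
  have "is_nat T A (prodE R_obj S) R_obj (\<lambda>B. fst)"
    by (auto simp: is_nat_def prodE_def)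
  from expE_universal(1)[OF A RF S this]
  have nat: "is_nat T A R_obj ?Y (str ?Y)" by (simp add: is_nat_def exp_ralg_sel)
  have "str ?Y B (opn B \<sigma> rs) = opE ?Y B \<sigma> (map (str ?Y B) rs)"
    if B: "B \<in> A" and \<sigma>: "\<sigma> \<in> ops T" and rs: "rs \<in> args T \<sigma> (car B)" for B \<sigma> rs
  proof (rule extensionalityI[OF _ exp_ralg_op(1)])
    show "str ?Y B (opn B \<sigma> rs) \<in> extensional (exp_dom T A S B)"
      by (simp add: exp_ralg_sel transpose_def)
    fix p assume p: "p \<in> exp_dom T A S B"
    then obtain D f q where q: "p = (D, f, q)" "D \<in> A" "f \<in> alg_hom T B D" "q \<in> ob S D"
      by (auto simp: exp_dom_def)
    show "str ?Y B (opn B \<sigma> rs) p = opE ?Y B \<sigma> (map (str ?Y B) rs) p"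
      using p q \<sigma> rs by (simp add: exp_ralg_op exp_ralg_sel transpose_def R_obj_def alg_hom_def comp_def)
  qed
  then have "talg_mor T A R_obj ?Y (str ?Y)" using nat by (simp add: talg_mor_def R_obj_def)
  then show ?thesis using talg by (simp add: is_ralg_def)
qed

section \<open>The Dirac map is a morphism of R-algebras\<close>

lemma R_ralg_sel: "ob R_ralg = car" "act R_ralg = (\<lambda>B D f. f)" "opE R_ralg = opn" "str R_ralg = (\<lambda>B r. r)"
  by (simp_all add: R_ralg_def R_obj_def talg.defs ralg.defs)

text \<open>The restriction along the inclusion of \<open>X \<pitchfork>\<^sub>R R\<close> is absorbed into the domain of the transpose.\<close>

lemma dirac_transpose: "dirac T A X = transpose T A X (homR T A X R_ralg) evalE"
  by (auto simp: dirac_def precompE_def transpose_def homR_incl_def fun_eq_iff exp_dom_def homR_def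
      restrict_def)

lemma dirac_apply:
  assumes "D \<in> A" "f \<in> alg_hom T B D" "\<theta> \<in> ob (homR T A X R_ralg) D"
  shows "dirac T A X B x (D, f, \<theta>) = \<theta> (D, alg_id D, act X B D f x)"
  using assms by (simp add: dirac_transpose transpose_def exp_dom_def evalE_def)

text \<open>The Dirac map evaluates each \<theta> at its argument, so it preserves operations and
  structure maps exactly because every \<theta> in \<open>homR\<close> does. This is the point of
  restricting from all maps X \<rightarrow> R to the R-algebra morphisms.\<close>

lemma dirac_ralg_mor:
  assumes A: "\<forall>M\<in>A. is_alg T M" and X: "is_ralg T A X"
  shows "ralg_mor T A X (exp_ralg T A (homR T A X R_ralg)) (dirac T A X)"
proof -
  let ?S = "homR T A X R_ralg"
  let ?Y = "exp_ralg T A ?S"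
  note XF = is_ralgD(1)[OF X] and RF = is_ralgD(1)[OF is_ralg_R_ralg[OF A]]
  note S = homR_functor[OF A X RF]
  \<comment> \<open>\<open>R_ralg\<close> and \<open>R_obj\<close> have the same sets and actions,
    so evaluation restricts along the inclusion of \<open>homR\<close>.\<close>
  have "is_nat T A (prodE X ?S) R_obj evalE"
    using evalE_nat[OF A XF, of R_ralg] homR_ob(1)[of _ T A X R_ralg]
    by (auto simp: is_nat_def prodE_def R_obj_def R_ralg_sel homR_act)
  from expE_universal(1)[OF A XF S this]
  have nat: "is_nat T A X ?Y (dirac T A X)"
    by (simp add: is_nat_def exp_ralg_sel dirac_transpose)
  have ext: "dirac T A X B x \<in> extensional (exp_dom T A ?S B)" for B x
    by (simp add: dirac_transpose transpose_def)
  have "dirac T A X B (opE X B \<sigma> xs) = opE ?Y B \<sigma> (map (dirac T A X B) xs)"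
    if B: "B \<in> A" and \<sigma>: "\<sigma> \<in> ops T" and xs: "xs \<in> args T \<sigma> (ob X B)" for B \<sigma> xs
  proof (rule extensionalityI[OF ext exp_ralg_op(1)])
    fix p assume "p \<in> exp_dom T A ?S B"
    then obtain D f \<theta> where p: "p = (D, f, \<theta>)" "D \<in> A" "f \<in> alg_hom T B D" "\<theta> \<in> ob ?S D"
      by (auto simp: exp_dom_def)
    have "map (act X B D f) xs \<in> args T \<sigma> (ob X D)"
      using xs is_functorD(1)[OF XF B p(2,3)] by (auto simp: args_def)
    then show "dirac T A X B (opE X B \<sigma> xs) p = opE ?Y B \<sigma> (map (dirac T A X B) xs) p"
      using p A is_ralgD(4)[OF X B p(2,3) \<sigma> xs] homR_ob(2)[OF p(4,2) alg_id_hom \<sigma>]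
      by (simp add: exp_ralg_op dirac_apply R_ralg_sel comp_def)
  qed
  moreover have "dirac T A X B (str X B r) = str ?Y B r" if B: "B \<in> A" and r: "r \<in> car B" for B r
  proof (rule extensionalityI[OF ext])
    show "str ?Y B r \<in> extensional (exp_dom T A ?S B)" by (simp add: exp_ralg_sel transpose_def)
    fix p assume d: "p \<in> exp_dom T A ?S B"
    then obtain D f \<theta> where p: "p = (D, f, \<theta>)" "D \<in> A" "f \<in> alg_hom T B D" "\<theta> \<in> ob ?S D"
      by (auto simp: exp_dom_def)
    have "f r \<in> car D" using p(3) r by (auto simp: alg_hom_def)
    then show "dirac T A X B (str X B r) p = str ?Y B r p"
      using d p A is_ralgD(6)[OF X B p(2,3) r] homR_ob(3)[OF p(4,2) alg_id_hom]
      by (simp add: dirac_apply exp_ralg_sel transpose_def R_obj_def R_ralg_sel)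
  qed
  ultimately show ?thesis
    using nat X is_ralg_exp_ralg[OF A S] by (auto simp: ralg_mor_def talg_mor_def)
qed

section \<open>Representing \<open>(R \<otimes> \<gamma>\<^sup>*(C)) \<pitchfork>\<^sub>R R\<close>\<close>

abbreviation (input) RC :: "'f alg_theory \<Rightarrow> ('f, 'a) alg \<Rightarrow> ('f, 'a, ('f, 'a + 'a) trm set) ralg" where
  "RC T C \<equiv> R_tensor T (gamma_obj C)"

lemma RC_sel:
  "ob (RC T C) B = car (alg_coprod T B C)" "opE (RC T C) B = opn (alg_coprod T B C)"
  "str (RC T C) B = alg_inl T B C"
  by (simp_all add: R_tensor_sel tensorE_def inlE_def alg_at_R_obj alg_at_gamma_obj)

text \<open>The action is f \<otimes> id. By \<open>coprod_map_unique\<close> these three facts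
  determine it, and its definition by unions over representatives is not unfolded again.\<close>

lemma RC_act:
  assumes T: "wf_theory T" and A: "\<forall>M\<in>A. is_alg T M" and C: "is_alg T C"
    and B: "B \<in> A" and D: "D \<in> A" and f: "f \<in> alg_hom T B D"
  shows "alg_map T (alg_coprod T B C) (alg_coprod T D C) (act (RC T C) B D f)"
    and "x \<in> car B \<Longrightarrow> act (RC T C) B D f (alg_inl T B C x) = alg_inl T D C (f x)"
    and "c \<in> car C \<Longrightarrow> act (RC T C) B D f (alg_inr T B C c) = alg_inr T D C c"
proof -
  note R = is_talg_R_obj[OF A] and G = is_talg_gamma_obj[OF C, of A]
  obtain u where u: "u \<in> alg_hom T (alg_coprod T B C) (alg_coprod T D C)"
    "\<forall>U\<in>car (alg_coprod T B C). act (RC T C) B D f U = u U"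
    using tensorE_act(2)[OF T R G B D f]
    by (auto simp: alg_at_R_obj alg_at_gamma_obj R_tensor_sel(2) RC_sel(1)[unfolded R_tensor_sel(1)])
  then show "alg_map T (alg_coprod T B C) (alg_coprod T D C) (act (RC T C) B D f)"
    using alg_map_cong[OF is_alg_coprod[OF T], of B C "act (RC T C) B D f" u] by (simp add: alg_hom_iff)
  show "act (RC T C) B D f (alg_inl T B C x) = alg_inl T D C (f x)" if "x \<in> car B"
    using is_ralgD(6)[OF is_ralg_R_tensor[OF T A G] B D f that] by (simp add: RC_sel)
  show "act (RC T C) B D f (alg_inr T B C c) = alg_inr T D C c" if "c \<in> car C"
    using inlE_inrE_mor(2)[OF T R G] B D f that
    by (simp add: talg_mor_def is_nat_def inrE_def alg_at_R_obj alg_at_gamma_obj R_tensor_sel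
        gamma_obj_sel)
qed

text \<open>The element of \<open>X \<pitchfork>\<^sub>R R\<close> at stage \<open>B\<close> that corresponds to \<open>g : C \<rightarrow> B\<close>, where \<open>X\<close> is \<open>RC T C\<close>.\<close>

definition yon :: "'f alg_theory \<Rightarrow> ('f, 'a) alg set \<Rightarrow> ('f, 'a) alg \<Rightarrow> ('f, 'a) alg \<Rightarrow> ('a \<Rightarrow> 'a)
    \<Rightarrow> ('f, 'a, ('f, 'a + 'a) trm set, 'a) expel" where
  "yon T A C B g = (\<lambda>(D, f, u)\<in>exp_dom T A (RC T C) B. copair T D C D (\<lambda>x. x) (\<lambda>c. f (g c)) u)"

section \<open>Maps out of B \<otimes> C for B in \<open>A\<close>\<close>

context
  fixes T :: "'f alg_theory" and A :: "('f, 'a) alg set" and C :: "('f, 'a) alg"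
  assumes T: "wf_theory T" and A: "\<forall>M\<in>A. is_alg T M" and C: "C \<in> A"
begin

lemma algA: "M \<in> A \<Longrightarrow> is_alg T M"
  using A by blast

lemmas RC_ralg = is_ralg_R_tensor[OF T A is_talg_gamma_obj[OF algA[OF C]]]
lemmas RC_act_A = RC_act[OF T A algA[OF C]]
lemmas C_inj_map = alg_inl_inr_map[OF _ algA[OF C]]

lemma copairC:
  assumes "B \<in> A" "D \<in> A" "alg_map T B D h" "alg_map T C D k"
  shows "alg_map T (alg_coprod T B C) D (copair T B C D h k)"
    and "x \<in> car B \<Longrightarrow> copair T B C D h k (alg_inl T B C x) = h x"
    and "y \<in> car C \<Longrightarrow> copair T B C D h k (alg_inr T B C y) = k y"
  using copair[OF T algA[OF assms(1)] algA[OF C] algA[OF assms(2)] assms(3,4)] by auto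

text \<open>The law [h, k] \<circ> (f \<otimes> id) = [h \<circ> f, k], checked on the two
  injections.\<close>

lemma copair_act:
  assumes B: "B \<in> A" and D: "D \<in> A" and E: "E \<in> A" and f: "f \<in> alg_hom T B D"
    and h: "alg_map T D E h" and k: "alg_map T C E k"
    and u: "u \<in> car (alg_coprod T B C)"
  shows "copair T D C E h k (act (RC T C) B D f u) = copair T B C E (\<lambda>x. h (f x)) k u"
proof -
  note a = RC_act_A[OF B D f]
  note c = copairC[OF D E h k]
  note hf = alg_map_comp[OF alg_hom_map[OF f] h]
  note c' = copairC[OF B E hf k]
  show ?thesis
    using alg_mapD(1)[OF alg_hom_map[OF f]]
    by (intro coprod_map_unique[OF T algA[OF B] algA[OF C] algA[OF E] alg_map_comp[OF a(1) c(1)] c'(1) _ _ u])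
      (simp_all add: a(2,3) c(2,3) c'(2,3))
qed

lemma comp_copair:
  assumes B: "B \<in> A" and D: "D \<in> A" and E: "E \<in> A"
    and h: "alg_map T B D h" and k: "alg_map T C D k" and m: "alg_map T D E m"
    and u: "u \<in> car (alg_coprod T B C)"
  shows "m (copair T B C D h k u) = copair T B C E (\<lambda>x. m (h x)) (\<lambda>c. m (k c)) u"
proof -
  note c = copairC[OF B D h k]
  note c' = copairC[OF B E alg_map_comp[OF h m] alg_map_comp[OF k m]]
  show ?thesis
    by (intro coprod_map_unique[OF T algA[OF B] algA[OF C] algA[OF E] alg_map_comp[OF c(1) m] c'(1) _ _ u])
      (simp_all add: c(2,3) c'(2,3))
qed

section \<open>Elements of S given by homomorphisms out of C\<close>

lemma yon_apply:
  assumes "D \<in> A" "f \<in> alg_hom T B D" "u \<in> car (alg_coprod T D C)"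
  shows "yon T A C B g (D, f, u) = copair T D C D (\<lambda>x. x) (\<lambda>c. f (g c)) u"
  using assms by (simp add: yon_def exp_dom_def RC_sel)

text \<open>The component at (D, f) is [id, f \<circ> g], a homomorphism restricting to the identity
  on D. For naturality along e, both sides reduce to [e, e \<circ> f \<circ> g] by
  \<open>copair_act\<close> and \<open>comp_copair\<close>.\<close>

lemma yon_homR:
  assumes B: "B \<in> A" and g: "g \<in> alg_hom T C B"
  shows "yon T A C B g \<in> ob (homR T A (RC T C) R_ralg) B"
proof -
  let ?\<theta> = "yon T A C B g"
  have k: "alg_map T C D (\<lambda>c. f (g c))" if "f \<in> alg_hom T B D" for D f
    using alg_map_comp[OF alg_hom_map[OF g] alg_hom_map[OF that]] .
  note c = copairC[OF _ _ alg_map_ident k]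
  have "?\<theta> (D, f, u) \<in> car D"
    if "D \<in> A" "f \<in> alg_hom T B D" "u \<in> car (alg_coprod T D C)" for D f u
    using alg_mapD(1)[OF c(1)[OF that(1,1,2)] that(3)] that by (simp add: yon_apply)
  moreover have "?\<theta> (E, compose (car B) e f, act (RC T C) D E e u) = e (?\<theta> (D, f, u))"
    if D: "D \<in> A" "E \<in> A" "f \<in> alg_hom T B D" "e \<in> alg_hom T D E" "u \<in> car (alg_coprod T D C)" for D E f e u
  proof -
    have ef: "compose (car B) e f \<in> alg_hom T B E" by (rule alg_hom_compose[OF algA[OF B] D(3,4)])
    \<comment> \<open>\<open>compose\<close> agrees with e \<circ> f only on the carrier of B, which
      suffices because g takes its values there.\<close>
    have "copair T D C E (\<lambda>x. e x) (\<lambda>c. compose (car B) e f (g c)) u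
        = copair T D C E (\<lambda>x. e x) (\<lambda>c. e (f (g c))) u"
      using alg_mapD(1)[OF alg_hom_map[OF g]] by (simp add: compose_def cong: copair_cong)
    then show ?thesis
      using yon_apply[OF D(2) ef alg_mapD(1)[OF RC_act_A(1)[OF D(1,2,4)] D(5)]] yon_apply[OF D(1,3,5)]
        copair_act[OF D(1,2,2,4) alg_map_ident k[OF ef] D(5)]
        comp_copair[OF D(1,1,2) alg_map_ident k[OF D(3)] alg_hom_map[OF D(4)] D(5)] by simp
  qed
  moreover have "?\<theta> (D, f, opn (alg_coprod T D C) \<sigma> us) = opn D \<sigma> (map (\<lambda>u. ?\<theta> (D, f, u)) us)"
    if D: "D \<in> A" "f \<in> alg_hom T B D" and \<sigma>: "\<sigma> \<in> ops T" "us \<in> args T \<sigma> (car (alg_coprod T D C))" for D f \<sigma> us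
  proof -
    have "opn (alg_coprod T D C) \<sigma> us \<in> car (alg_coprod T D C)"
      using is_alg_coprod[OF T, of D C] \<sigma> by (simp add: is_alg_def)
    moreover have "map (\<lambda>u. ?\<theta> (D, f, u)) us = map (copair T D C D (\<lambda>x. x) (\<lambda>c. f (g c))) us"
      using \<sigma>(2) D by (intro map_cong) (auto simp: args_def yon_apply subset_iff)
    ultimately show ?thesis
      using alg_mapD(2)[OF c(1)[OF D(1,1,2)] \<sigma>] D by (simp add: yon_apply cong: map_cong)
  qed
  moreover have "?\<theta> (D, f, alg_inl T D C r) = r" if "D \<in> A" "f \<in> alg_hom T B D" "r \<in> car D" for D f r
    using c(2)[OF that(1,1,2,3)] alg_mapD(1)[OF C_inj_map(1)[OF algA[OF that(1)]] that(3)] that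
    by (simp add: yon_apply)
  moreover have "?\<theta> \<in> extensional (exp_dom T A (RC T C) B)" by (simp add: yon_def)
  ultimately show ?thesis by (simp add: homR_def expE_def RC_sel R_ralg_sel)
qed

text \<open>The homomorphism g is read off from \<theta> at the identity of B along the second
  injection. Naturality of \<theta> then fixes its values on C at every other stage.\<close>

lemma homR_yon:
  assumes B: "B \<in> A" and \<theta>: "\<theta> \<in> ob (homR T A (RC T C) R_ralg) B"
  obtains g where "g \<in> alg_hom T C B" "\<theta> = yon T A C B g"
proof
  let ?g = "restrict (\<lambda>c. \<theta> (B, alg_id B, alg_inr T B C c)) (car C)"
  note E = homR_ob(1)[OF \<theta>]
  have map: "alg_map T (alg_coprod T D C) D (\<lambda>u. \<theta> (D, f, u))" if "D \<in> A" "f \<in> alg_hom T B D" for D f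
    using expE_ob(2)[OF E that] homR_ob(2)[OF \<theta> that] by (simp add: alg_map_def RC_sel R_ralg_sel)
  note id = alg_id_hom[OF algA[OF B]]
  show g: "?g \<in> alg_hom T C B"
    using alg_map_restrict[OF algA[OF C] alg_map_comp[OF C_inj_map(2)[OF algA[OF B]] map[OF B id]]] .
  \<comment> \<open>Transport from the identity stage along f: the action fixes the second injection
    since the algebra of C is constant.\<close>
  have nat: "\<theta> (D, f, alg_inr T D C c) = f (?g c)" if D: "D \<in> A" "f \<in> alg_hom T B D" "c \<in> car C" for D f c
    using expE_ob(3)[OF E B D(1) id D(2), of "alg_inr T B C c"] D
      alg_mapD(1)[OF C_inj_map(2)[OF algA[OF B]] D(3)] RC_act_A(3)[OF B D]
    by (simp add: RC_sel R_ralg_sel compose_alg_hom(1)[OF D(2)])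
  show "\<theta> = yon T A C B ?g"
  proof (rule extensionalityI[OF expE_ob(1)[OF E] expE_ob(1)[OF homR_ob(1)[OF yon_homR[OF B g]]]])
    fix p assume "p \<in> exp_dom T A (RC T C) B"
    then obtain D f u where p: "p = (D, f, u)" "D \<in> A" "f \<in> alg_hom T B D" "u \<in> car (alg_coprod T D C)"
      by (auto simp: exp_dom_def RC_sel)
    note c = copairC[OF p(2,2) alg_map_ident alg_map_comp[OF alg_hom_map[OF g] alg_hom_map[OF p(3)]]]
    have "\<theta> (D, f, u) = copair T D C D (\<lambda>x. x) (\<lambda>c. f (?g c)) u"
    proof (rule coprod_map_unique[OF T algA[OF p(2)] algA[OF C] algA[OF p(2)] map[OF p(2,3)] c(1) _ _ p(4)])
      show "\<theta> (D, f, alg_inl T D C x) = copair T D C D (\<lambda>x. x) (\<lambda>c. f (?g c)) (alg_inl T D C x)"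
        if "x \<in> car D" for x
        using homR_ob(3)[OF \<theta> p(2,3) that] c(2)[OF that] by (simp add: RC_sel R_ralg_sel)
      show "\<theta> (D, f, alg_inr T D C y) = copair T D C D (\<lambda>x. x) (\<lambda>c. f (?g c)) (alg_inr T D C y)"
        if "y \<in> car C" for y
        using nat[OF p(2,3) that] c(3)[OF that] by simp
    qed
    then show "\<theta> p = yon T A C B ?g p" using p by (simp add: yon_apply)
  qed
qed

text \<open>Acting by f precomposes the stage arrow h with f, so the claim is associativity of
  composition. It makes g \<mapsto> \<open>yon\<close> natural, as the Yoneda argument
  requires.\<close>

lemma yon_act:
  assumes B: "B \<in> A" and D: "D \<in> A" and f: "f \<in> alg_hom T B D" and g: "g \<in> alg_hom T C B"
  shows "act (homR T A (RC T C) R_ralg) B D f (yon T A C B g) = yon T A C D (compose (car C) f g)"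
proof (rule extensionalityI)
  show "act (homR T A (RC T C) R_ralg) B D f (yon T A C B g) \<in> extensional (exp_dom T A (RC T C) D)"
    by (simp add: homR_def expE_def)
  show "yon T A C D (compose (car C) f g) \<in> extensional (exp_dom T A (RC T C) D)"
    by (simp add: yon_def)
  fix p assume "p \<in> exp_dom T A (RC T C) D"
  then obtain E h u where p: "p = (E, h, u)" "E \<in> A" "h \<in> alg_hom T D E" "u \<in> car (alg_coprod T E C)"
    by (auto simp: exp_dom_def RC_sel)
  have hf: "compose (car B) h f \<in> alg_hom T B E" by (rule alg_hom_compose[OF algA[OF B] f p(3)])
  have "copair T E C E (\<lambda>x. x) (\<lambda>c. compose (car B) h f (g c)) u
      = copair T E C E (\<lambda>x. x) (\<lambda>c. h (compose (car C) f g c)) u"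
    using alg_mapD(1)[OF alg_hom_map[OF g]] by (simp add: compose_def cong: copair_cong)
  then show "act (homR T A (RC T C) R_ralg) B D f (yon T A C B g) p = yon T A C D (compose (car C) f g) p"
    using p hf by (simp add: homR_act expE_act RC_sel yon_apply)
qed

section \<open>The Dirac map under this representation\<close>

lemma dirac_yon:
  assumes B: "B \<in> A" and D: "D \<in> A" and f: "f \<in> alg_hom T B D" and g: "g \<in> alg_hom T C D"
    and u: "u \<in> car (alg_coprod T B C)"
  shows "dirac T A (RC T C) B u (D, f, yon T A C D g) = copair T B C D f g u"
proof -
  note id = alg_id_hom[OF algA[OF D]]
  note a = RC_act_A[OF B D f]
  note k = alg_map_comp[OF alg_hom_map[OF g] alg_hom_map[OF id]]
  have "copair T B C D f (\<lambda>c. alg_id D (g c)) u = copair T B C D f g u"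
    using alg_mapD(1)[OF alg_hom_map[OF g]] by (simp add: alg_id_def cong: copair_cong)
  \<comment> \<open>The left side is [id, g] applied to (f \<otimes> id)(u), and
    \<open>copair_act\<close> fuses the two maps.\<close>
  then show ?thesis
    using dirac_apply[OF D f yon_homR[OF D g]] yon_apply[OF D id alg_mapD(1)[OF a(1) u]]
      copair_act[OF B D D f alg_map_ident k u] by simp
qed

lemma dirac_bij:
  assumes B: "B \<in> A" and P: "P \<in> A" and iso: "alg_isomorphic T P (alg_coprod T B C)"
  shows "bij_betw (dirac T A (RC T C) B) (ob (RC T C) B) (ob (exp_ralg T A (homR T A (RC T C) R_ralg)) B)"
proof -
  let ?X = "RC T C"
  let ?S = "homR T A ?X R_ralg"
  obtain h k where h: "h \<in> alg_hom T P (alg_coprod T B C)" and k: "k \<in> alg_hom T (alg_coprod T B C) P"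
    and kh: "compose (car P) k h = alg_id P" and hk: "compose (car (alg_coprod T B C)) h k = alg_id (alg_coprod T B C)"
    using iso by (auto simp: alg_isomorphic_def)
  have hk': "h (k u) = u" if "u \<in> car (alg_coprod T B C)" for u
    using fun_cong[OF hk, of u] that by (simp add: alg_id_def compose_def)
  have kh': "k (h p) = p" if "p \<in> car P" for p
    using fun_cong[OF kh, of p] that by (simp add: alg_id_def compose_def)
  note inj = C_inj_map[OF algA[OF B]]
  \<comment> \<open>The coproduct injections carried to P by k: the universal pair, now between
    objects of \<open>A\<close>.\<close>
  define i where "i = restrict (\<lambda>x. k (alg_inl T B C x)) (car B)"
  define j where "j = restrict (\<lambda>c. k (alg_inr T B C c)) (car C)"
  have i: "i \<in> alg_hom T B P" and j: "j \<in> alg_hom T C P"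
    unfolding i_def j_def
    using alg_map_restrict[OF algA[OF B] alg_map_comp[OF inj(1) alg_hom_map[OF k]]]
      alg_map_restrict[OF algA[OF C] alg_map_comp[OF inj(2) alg_hom_map[OF k]]] by auto
  have ij: "copair T B C P i j u = k u" if u: "u \<in> car (alg_coprod T B C)" for u
    using alg_hom_map[OF k]
    by (intro coprod_map_unique[OF T algA[OF B] algA[OF C] algA[OF P] copairC(1)[OF B P alg_hom_map[OF i] alg_hom_map[OF j]]
          _ _ _ u])
      (simp_all add: copairC(2,3)[OF B P alg_hom_map[OF i] alg_hom_map[OF j]], simp_all add: i_def j_def)
  \<comment> \<open>Evaluating both images at the universal pair gives k u = k u', and h undoes
    k.\<close>
  have "u = u'" if "u \<in> ob ?X B" "u' \<in> ob ?X B" "dirac T A ?X B u = dirac T A ?X B u'" for u u'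
    using that dirac_yon[OF B P i j] ij hk' by (metis RC_sel(1))
  moreover have "dirac T A ?X B u \<in> ob (exp_ralg T A ?S) B" if "u \<in> ob ?X B" for u
    using dirac_ralg_mor[OF A RC_ralg] B that by (auto simp: ralg_mor_def talg_mor_def is_nat_def)
  moreover have "\<Phi> \<in> dirac T A ?X B ` ob ?X B" if \<Phi>: "\<Phi> \<in> ob (exp_ralg T A ?S) B" for \<Phi>
  proof -
    note E = \<Phi>[unfolded exp_ralg_sel]
    \<comment> \<open>The value of \<Phi> at the universal pair; its image h p in B \<otimes> C is
      the preimage sought.\<close>
    define p where "p = \<Phi> (P, i, yon T A C P j)"
    have p: "p \<in> car P"
      using expE_ob(2)[OF E P i yon_homR[OF P j]] by (simp add: p_def R_obj_def)
    have u: "h p \<in> car (alg_coprod T B C)" by (rule alg_mapD(1)[OF alg_hom_map[OF h] p])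
    \<comment> \<open>Yoneda: \<open>\<Phi>\<close> is determined by its value at the universal pair \<open>(i, j)\<close>, as \<open>(f, g)\<close> is its image under \<open>m = [f, g]\<close>.\<close>
    have "dirac T A ?X B (h p) = \<Phi>"
    proof (rule extensionalityI[OF _ expE_ob(1)[OF E]])
      show "dirac T A ?X B (h p) \<in> extensional (exp_dom T A ?S B)"
        by (simp add: dirac_transpose transpose_def)
      fix q assume "q \<in> exp_dom T A ?S B"
      then obtain D f \<theta> where q: "q = (D, f, \<theta>)" "D \<in> A" "f \<in> alg_hom T B D" "\<theta> \<in> ob ?S D"
        by (auto simp: exp_dom_def)
      obtain g where g: "g \<in> alg_hom T C D" "\<theta> = yon T A C D g" by (rule homR_yon[OF q(2,4)])
      note c = copairC[OF B q(2) alg_hom_map[OF q(3)] alg_hom_map[OF g(1)]]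
      define m where "m = restrict (\<lambda>x. copair T B C D f g (h x)) (car P)"
      have m: "m \<in> alg_hom T P D"
        unfolding m_def by (rule alg_map_restrict[OF algA[OF P] alg_map_comp[OF alg_hom_map[OF h] c(1)]])
      have "compose (car B) m i = f"
      proof (rule extensionalityI)
        \<comment> \<open>Here m (i x) is [f, g] at h (k (inl x)), and h cancels k.\<close>
        show "compose (car B) m i x = f x" if x: "x \<in> car B" for x
          using x alg_mapD(1)[OF alg_hom_map[OF i] x] alg_mapD(1)[OF inj(1) x] c(2)[OF x]
          by (simp add: compose_def m_def) (simp add: i_def hk')
      qed (use q(3) in \<open>auto simp: alg_hom_iff\<close>)
      moreover have "compose (car C) m j = g"
      proof (rule extensionalityI)
        show "compose (car C) m j x = g x" if x: "x \<in> car C" for x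
          using x alg_mapD(1)[OF alg_hom_map[OF j] x] alg_mapD(1)[OF inj(2) x] c(3)[OF x]
          by (simp add: compose_def m_def) (simp add: j_def hk')
      qed (use g(1) in \<open>auto simp: alg_hom_iff\<close>)
      \<comment> \<open>Naturality of \<Phi> along m, where \<open>yon_act\<close> identifies the
        translate of \<open>yon T A C P j\<close> with that of m \<circ> j = g.\<close>
      ultimately have "\<Phi> (D, f, yon T A C D g) = m p"
        using expE_ob(3)[OF E P q(2) i m yon_homR[OF P j]] yon_act[OF P q(2) m j]
        by (simp add: p_def R_obj_def)
      then show "dirac T A ?X B (h p) q = \<Phi> q"
        using dirac_yon[OF B q(2,3) g(1) u] p q(1) g(2) by (simp add: m_def)
    qed
    then show ?thesis using u by (auto simp: RC_sel)
  qed
  ultimately show ?thesis by (auto simp: bij_betw_def inj_on_def)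
qed

end

theorem theorem6:
  fixes T :: "'f alg_theory" and A :: "('f, 'a) alg set" and C :: "('f, 'a) alg"
  assumes "wf_theory T"
    and "\<forall>M\<in>A. is_alg T M"
    and "closed_fin_coprod T A"
    and "C \<in> A"
  shows "ralg_iso T A (R_tensor T (gamma_obj C))
           (exp_ralg T A (homR T A (R_tensor T (gamma_obj C)) R_ralg))
           (dirac T A (R_tensor T (gamma_obj C)))"
proof (rule ralg_mor_bij_iso[OF dirac_ralg_mor[OF assms(2) RC_ralg[OF assms(1,2,4)]]])
  fix B assume B: "B \<in> A"
  \<comment> \<open>The choices of P at different B need not be compatible, since the Dirac map is
    already known to be natural.\<close>
  then obtain P where "P \<in> A" "alg_isomorphic T P (alg_coprod T B C)"
    using assms(3,4) by (auto simp: closed_fin_coprod_def)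
  then show "bij_betw (dirac T A (R_tensor T (gamma_obj C)) B) (ob (R_tensor T (gamma_obj C)) B)
      (ob (exp_ralg T A (homR T A (R_tensor T (gamma_obj C)) R_ralg)) B)"
    by (rule dirac_bij[OF assms(1,2,4) B])
qed

end
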